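(* Let $r:\mathbb{R}/2\pi\mathbb{Z}\to\mathbb{R}_{>0}$ be $\alpha$-Hölder continuous for some $\alpha>\tfrac12$. Then for $\operatorname{Re}(s)>1$, $$Z_r(s)=\sum_{q=-\infty}^{\infty}i^{q}\,\widehat{r^{2s}}(q)\,(E^\sharp.f_q)(I,s),$$ and the right-hand side converges absolutely on the half-plane $\operatorname{Re}(s)>1$.
   Context: $Z_r(s)=\sum_{(m,n)\in\mathbb{Z}^2\setminus\{0\}}r(\theta(m,n))^{2s}(m^2+n^2)^{-s}$, where $\theta(m,n)$ is the angle of $(m,n)$ from the positive $x$-axis (the Hlawka zeta function of the region $\{(\rho\cos\theta,\rho\sin\theta):0\le\rho\le r(\theta)\}$). A function $f$ is $\alpha$-Hölder continuous if there is $C$ with $|f(x)-f(y)|\le C|x-y|^\alpha$ for all $x,y$. $\widehat{r^{2s}}(q)=\frac1{2\pi}\int_0^{2\pi}r(\theta)^{2s}e^{-iq\theta}d\theta$. For $g\in SL(2,\mathbb{R})$ write uniquely $g=\begin{pmatrix}1&x\\0&1\end{pmatrix}\begin{pmatrix}y^{1/2}&0\\0&y^{-1/2}\end{pmatrix}\kappa_\theta$ with $y>0$, $\kappa_\theta=\begin{pmatrix}\cos\theta&\sin\theta\\-\sin\theta&\cos\theta\end{pmatrix}$, and set $f_q(s,g)=y^se^{iq\theta}$. With $\Gamma^\infty_+=\{\begin{pmatrix}1&n\\0&1\end{pmatrix}:n\in\mathbb{Z}\}$, define for $\operatorname{Re}(s)>1$: $(E^\sharp.f_q)(g,s)=\zeta(2s)\sum_{\gamma\in\Gamma^\infty_+\backslash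 SL(2,\mathbb{Z})}f_q(s,\gamma g)$. In particular $(E^\sharp.f_q)(I,s)=\sum_{(m,n)\neq(0,0)}\frac{(-i)^qe^{iq\theta(m,n)}}{(m^2+n^2)^s}$. *)

theory Defs
  imports "HOL-Analysis.Analysis" "HOL-Algebra.Coset"
begin

text \<open>
  Functions on the circle are represented by \<open>2\<pi>\<close>-periodic functions on the reals.  For these,
  the condition below is the same as Hoelder continuity with respect to arc length on the circle.
\<close>

definition holder_continuous :: "real \<Rightarrow> (real \<Rightarrow> real) \<Rightarrow> bool" where
  "holder_continuous \<alpha> f \<longleftrightarrow> (\<exists>C. \<forall>x y. \<bar>f x - f y\<bar> \<le> C * \<bar>x - y\<bar> powr \<alpha>)"

definition fourier_coeff :: "(real \<Rightarrow> complex) \<Rightarrow> int \<Rightarrow> complex" where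
  "fourier_coeff h q =
     1 / (2 * of_real pi) * integral {0..2 * pi} (\<lambda>\<theta>. h \<theta> * exp (- \<i> * of_int q * of_real \<theta>))"

text \<open>The choice of range \<open>(-\<pi>, \<pi>]\<close> for \<^const>\<open>Arg\<close> is immaterial, by periodicity of \<open>r\<close>.\<close>

definition hlawka_zeta :: "(real \<Rightarrow> real) \<Rightarrow> complex \<Rightarrow> complex" where
  "hlawka_zeta r s =
     (\<Sum>\<^sub>\<infinity>(m, n) \<in> (UNIV :: (int \<times> int) set) - {(0, 0)}.
        of_real (r (Arg (Complex (of_int m) (of_int n)))) powr (2 * s)
          * of_real (of_int (m\<^sup>2 + n\<^sup>2)) powr (- s))"

text \<open>The Dirichlet series, i.e. the Riemann zeta function on the half-plane \<open>Re s > 1\<close> only.\<close>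

definition zeta_series :: "complex \<Rightarrow> complex" where
  "zeta_series s = (\<Sum>n. of_nat (Suc n) powr (- s))"

definition mat2 :: "real \<Rightarrow> real \<Rightarrow> real \<Rightarrow> real \<Rightarrow> real ^ 2 ^ 2" where
  "mat2 a b c d = vector [vector [a, b], vector [c, d]]"

definition SL2R :: "(real ^ 2 ^ 2) monoid" where
  "SL2R = \<lparr>carrier = {g. det g = 1}, mult = (**), one = mat 1\<rparr>"

definition SL2Z :: "(real ^ 2 ^ 2) monoid" where
  "SL2Z = SL2R\<lparr>carrier := {g \<in> carrier SL2R. \<forall>i j. g $ i $ j \<in> \<int>}\<rparr>"

definition Gamma_inf_plus :: "(real ^ 2 ^ 2) set" where
  "Gamma_inf_plus = {mat2 1 (of_int n) 0 1 | n :: int. True}"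

definition is_iwasawa :: "real ^ 2 ^ 2 \<Rightarrow> real \<Rightarrow> real \<Rightarrow> real \<Rightarrow> bool" where
  "is_iwasawa g x y \<theta> \<longleftrightarrow> y > 0 \<and>
     g = mat2 1 x 0 1 ** mat2 (sqrt y) 0 0 (1 / sqrt y) ** mat2 (cos \<theta>) (sin \<theta>) (- sin \<theta>) (cos \<theta>)"

text \<open>
  The angle of the decomposition is unique only modulo \<open>2\<pi>\<close>, but the value below is unique;
  see \<open>iwasawa_fun_eq\<close>.
\<close>

definition iwasawa_fun :: "int \<Rightarrow> complex \<Rightarrow> real ^ 2 ^ 2 \<Rightarrow> complex" where
  "iwasawa_fun q s g =
     (THE w. \<exists>x y \<theta>. is_iwasawa g x y \<theta> \<and> w = of_real y powr s * exp (\<i> * of_int q * of_real \<theta>))"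

text \<open>
  A summand depends on the coset only, not on the chosen representative; see
  \<open>iwasawa_fun_representative\<close>.
\<close>

definition eisenstein_sharp ::
    "(complex \<Rightarrow> real ^ 2 ^ 2 \<Rightarrow> complex) \<Rightarrow> real ^ 2 ^ 2 \<Rightarrow> complex \<Rightarrow> complex" where
  "eisenstein_sharp f g s =
     zeta_series (2 * s) *
       (\<Sum>\<^sub>\<infinity>C \<in> rcosets\<^bsub>SL2Z\<^esub> Gamma_inf_plus. f s ((SOME \<gamma>. \<gamma> \<in> C) ** g))"

text \<open>The objects above are well defined, and all the series converge, for \<open>Re s > 1\<close>.\<close>

lemma mat2_nth [simp]:
  "mat2 a b c d $ 1 $ 1 = a" "mat2 a b c d $ 1 $ 2 = b"
  "mat2 a b c d $ 2 $ 1 = c" "mat2 a b c d $ 2 $ 2 = d"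
  by (simp_all add: mat2_def)

lemma mat2_eq_iff: "(g :: real^2^2) = h \<longleftrightarrow>
    g$1$1 = h$1$1 \<and> g$1$2 = h$1$2 \<and> g$2$1 = h$2$1 \<and> g$2$2 = h$2$2"
  by (auto simp: vec_eq_iff forall_2)

lemma matmul2_nth: "((g :: real^2^2) ** h) $ i $ j = g$i$1 * h$1$j + g$i$2 * h$2$j"
  by (simp add: matrix_matrix_mult_def sum_2)

lemma is_iwasawa_unique:
  assumes "is_iwasawa g x y \<theta>"
  shows "y = 1 / ((g$2$1)\<^sup>2 + (g$2$2)\<^sup>2)" and "cis \<theta> = sgn (Complex (g$2$2) (- g$2$1))"
proof -
  have y: "y > 0" and c: "g$2$1 = - sin \<theta> / sqrt y" and d: "g$2$2 = cos \<theta> / sqrt y"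
    using assms by (auto simp: is_iwasawa_def matmul2_nth)
  have "(g$2$1)\<^sup>2 + (g$2$2)\<^sup>2 = ((sin \<theta>)\<^sup>2 + (cos \<theta>)\<^sup>2) / y"
    unfolding c d add_divide_distrib using y by (simp add: power_divide)
  also have "\<dots> = 1 / y" by simp
  finally show "y = 1 / ((g$2$1)\<^sup>2 + (g$2$2)\<^sup>2)" by simp
  have "Complex (g$2$2) (- g$2$1) = of_real (1 / sqrt y) * cis \<theta>"
    unfolding c d by (simp add: complex_eq_iff)
  also have "sgn \<dots> = cis \<theta>"
    using y by (simp add: sgn_eq norm_divide)
  finally show "cis \<theta> = sgn (Complex (g$2$2) (- g$2$1))" ..
qed

lemma is_iwasawa_exists:
  assumes "det g = 1"
  shows "\<exists>x y \<theta>. is_iwasawa g x y \<theta>"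
proof -
  define a b c d where "a = g$1$1" and "b = g$1$2" and "c = g$2$1" and "d = g$2$2"
  have det: "a * d - b * c = 1"
    using assms by (simp add: det_2 a_def b_def c_def d_def)
  define z where "z = Complex d (- c)"
  have z: "z \<noteq> 0" using det by (auto simp: z_def complex_eq_iff)
  define n where "n = cmod z"
  have n: "n > 0" using z by (simp add: n_def)
  have n2: "n\<^sup>2 = c\<^sup>2 + d\<^sup>2" by (simp add: n_def z_def cmod_power2)
  define \<theta> where "\<theta> = Arg z"
  have "n * cos \<theta> = Re z" "n * sin \<theta> = Im z"
    using rcis_cmod_Arg[of z] by (metis Re_rcis n_def \<theta>_def, metis Im_rcis rcis_cmod_Arg n_def \<theta>_def)
  hence cs: "n * cos \<theta> = d" "n * sin \<theta> = - c" by (simp_all add: z_def)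
  define x where "x = (a * c + b * d) / n\<^sup>2"
  have sq: "sqrt (1 / n\<^sup>2) = 1 / n" using n by (simp add: real_sqrt_divide)
  have cs': "cos \<theta> = d / n" "sin \<theta> = - c / n" using cs n by (auto simp: field_simps)
  have "is_iwasawa g x (1 / n\<^sup>2) \<theta>"
    unfolding is_iwasawa_def
  proof (intro conjI)
    show "1 / n\<^sup>2 > 0" using n by simp
    have "a * n\<^sup>2 = d + (a * c + b * d) * c" "b * n\<^sup>2 = - c + (a * c + b * d) * d"
      using det unfolding n2 by algebra+
    moreover have "(d + x * n\<^sup>2 * c) / n\<^sup>2 = d / n\<^sup>2 + x * c"
      "(- c + x * n\<^sup>2 * d) / n\<^sup>2 = - c / n\<^sup>2 + x * d"
      using n by (simp_all add: add_divide_distrib diff_divide_distrib)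
    moreover have "a * c + b * d = x * n\<^sup>2" using n by (simp add: x_def)
    ultimately have "a = d / n\<^sup>2 + x * c" "b = - c / n\<^sup>2 + x * d"
      using n by (metis nonzero_mult_div_cancel_right power_not_zero less_irrefl)+
    thus "g = mat2 1 x 0 1 ** mat2 (sqrt (1 / n\<^sup>2)) 0 0 (1 / sqrt (1 / n\<^sup>2)) **
                mat2 (cos \<theta>) (sin \<theta>) (- sin \<theta>) (cos \<theta>)"
      unfolding mat2_eq_iff matmul2_nth sq cs' mat2_nth
      unfolding a_def [symmetric] b_def [symmetric] c_def [symmetric] d_def [symmetric]
      using n by (simp add: power2_eq_square)
  qed
  thus ?thesis by blast
qed

lemma iwasawa_fun_eq:
  assumes "det g = 1"
  shows "iwasawa_fun q s g = of_real (1 / ((g$2$1)\<^sup>2 + (g$2$2)\<^sup>2)) powr s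
           * sgn (Complex (g$2$2) (- g$2$1)) powi q" (is "_ = ?w")
proof -
  have *: "of_real y powr s * exp (\<i> * of_int q * of_real \<theta>) = ?w" if "is_iwasawa g x y \<theta>" for x y \<theta>
  proof -
    have "exp (\<i> * of_int q * of_real \<theta>) = cis \<theta> powi q"
      by (simp add: cis_power_int) (simp add: cis_conv_exp mult_ac)
    thus ?thesis using is_iwasawa_unique[OF that] by simp
  qed
  obtain x y \<theta> where "is_iwasawa g x y \<theta>"
    using is_iwasawa_exists[OF assms] by blast
  hence "\<exists>x y \<theta>. is_iwasawa g x y \<theta>
           \<and> ?w = of_real y powr s * exp (\<i> * of_int q * of_real \<theta>)"
    using *[symmetric] by blast
  thus ?thesis
    unfolding iwasawa_fun_def
  proof (rule the_equality)
    fix w assume "\<exists>x y \<theta>. is_iwasawa g x y \<theta>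
                    \<and> w = of_real y powr s * exp (\<i> * of_int q * of_real \<theta>)"
    thus "w = ?w" by (elim exE conjE) (simp only: *)
  qed
qed

lemma Gamma_inf_plus_coset:
  "Gamma_inf_plus #>\<^bsub>SL2Z\<^esub> \<gamma> = {mat2 1 (of_int n) 0 1 ** \<gamma> | n :: int. True}"
  by (auto simp: r_coset_def Gamma_inf_plus_def SL2Z_def SL2R_def)

lemma coset_bottom_row:
  assumes "\<gamma>' \<in> Gamma_inf_plus #>\<^bsub>SL2Z\<^esub> \<gamma>"
  shows "\<gamma>' $ 2 = \<gamma> $ 2" "det \<gamma>' = det \<gamma>"
  using assms unfolding Gamma_inf_plus_coset
  by (auto simp: vec_eq_iff forall_2 matmul2_nth det_2 algebra_simps)

lemma coset_self: "\<gamma> \<in> Gamma_inf_plus #>\<^bsub>SL2Z\<^esub> \<gamma>"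
proof -
  have "\<gamma> = mat2 1 (of_int 0) 0 1 ** \<gamma>" by (simp add: mat2_eq_iff matmul2_nth)
  thus ?thesis unfolding Gamma_inf_plus_coset by blast
qed

lemma iwasawa_fun_representative:
  assumes "\<gamma> \<in> carrier SL2Z" "det g = 1"
    and "\<gamma>' \<in> Gamma_inf_plus #>\<^bsub>SL2Z\<^esub> \<gamma>"
  shows "iwasawa_fun q s (\<gamma>' ** g) = iwasawa_fun q s (\<gamma> ** g)"
proof -
  have "det \<gamma> = 1" using assms(1) by (simp add: SL2Z_def SL2R_def)
  thus ?thesis
    using assms(2) coset_bottom_row[OF assms(3)]
    by (simp add: iwasawa_fun_eq det_mul matmul2_nth)
qed

lemma summable_on_int_powr:
  assumes "\<sigma> > 1"
  shows "(\<lambda>n::int. max 1 \<bar>of_int n :: real\<bar> powr (- \<sigma>)) summable_on UNIV"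
proof -
  have s: "summable (\<lambda>n::nat. max 1 (real n) powr (- \<sigma>))"
  proof (subst summable_cong)
    show "\<forall>\<^sub>F n in sequentially. max 1 (real n) powr (- \<sigma>) = real n powr (- \<sigma>)"
      using eventually_ge_at_top[of 1] by eventually_elim simp
    show "summable (\<lambda>n. real n powr (- \<sigma>))"
      using assms by (simp add: summable_real_powr_iff)
  qed
  have N: "(\<lambda>n. max 1 (real n) powr (- \<sigma>)) summable_on UNIV"
    by (rule norm_summable_imp_summable_on) (use s in simp)
  have P: "(\<lambda>n::int. max 1 \<bar>of_int n :: real\<bar> powr (- \<sigma>)) summable_on range (\<lambda>n. int n)"
    by (subst summable_on_reindex) (use N in \<open>auto simp: o_def inj_on_def\<close>)
  have M: "(\<lambda>n::int. max 1 \<bar>of_int n :: real\<bar> powr (- \<sigma>)) summable_on range (\<lambda>n. - int n)"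
    by (subst summable_on_reindex) (use N in \<open>auto simp: o_def inj_on_def\<close>)
  have "range (\<lambda>n. int n) \<union> range (\<lambda>n. - int n) = UNIV"
    by (metis (no_types, lifting) UNIV_eq_I UnI1 UnI2 int_cases2 rangeI)
  thus ?thesis using summable_on_union[OF P M] by simp
qed

lemma summable_on_lattice:
  assumes "\<sigma> > 1"
  shows "(\<lambda>(m, n). (of_int (m\<^sup>2 + n\<^sup>2) :: real) powr (- \<sigma>)) summable_on
           ((UNIV :: (int \<times> int) set) - {(0, 0)})"
proof -
  let ?u = "\<lambda>n::int. max 1 \<bar>of_int n :: real\<bar> powr (- \<sigma>)"
  have u: "?u summable_on UNIV" by (rule summable_on_int_powr[OF assms])
  have "(\<lambda>p. norm (case p of (m, n) \<Rightarrow> ?u m * ?u n)) summable_on (UNIV \<times> UNIV)"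
    unfolding Infinite_Sum.abs_summable_on_Sigma_iff
    using u by (simp add: abs_mult infsum_cmult_right' summable_on_cmult_right summable_on_cmult_left)
  hence "(\<lambda>p. norm (case p of (m, n) \<Rightarrow> ?u m * ?u n)) summable_on (UNIV - {(0, 0)})"
    by (rule summable_on_subset_banach) auto
  hence "(\<lambda>p. norm (case p of (m, n) \<Rightarrow> (of_int (m\<^sup>2 + n\<^sup>2) :: real) powr (- \<sigma>)))
           summable_on (UNIV - {(0, 0)})"
  proof (rule Infinite_Sum.abs_summable_on_comparison_test)
    fix p :: "int \<times> int" assume "p \<in> UNIV - {(0, 0)}"
    then obtain m n where p: "p = (m, n)" and "m = 0 \<longrightarrow> n \<noteq> 0" by (cases p) auto
    have "max 1 \<bar>m\<bar> * max 1 \<bar>n\<bar> \<le> m\<^sup>2 + n\<^sup>2"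
    proof (cases "m = 0 \<or> n = 0")
      case True
      have *: "max 1 \<bar>k\<bar> \<le> k\<^sup>2" if "k \<noteq> 0" for k :: int
      proof -
        have "1 * \<bar>k\<bar> \<le> \<bar>k\<bar> * \<bar>k\<bar>" using that by (intro mult_right_mono) auto
        thus ?thesis using that by (simp add: power2_eq_square)
      qed
      show ?thesis using True \<open>m = 0 \<longrightarrow> n \<noteq> 0\<close> *[of m] *[of n] by fastforce
    next
      case False
      hence "max 1 \<bar>m\<bar> = \<bar>m\<bar>" "max 1 \<bar>n\<bar> = \<bar>n\<bar>" by auto
      hence "max 1 \<bar>m\<bar> * max 1 \<bar>n\<bar> = \<bar>m\<bar> * \<bar>n\<bar>" by (simp only:)
      also have "\<dots> \<le> 2 * (\<bar>m\<bar> * \<bar>n\<bar>)" by simp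
      also have "\<dots> \<le> \<bar>m\<bar>\<^sup>2 + \<bar>n\<bar>\<^sup>2"
        using zero_le_power2[of "\<bar>m\<bar> - \<bar>n\<bar>"] by (simp only: power2_diff mult.assoc)
      finally show ?thesis by simp
    qed
    hence "real_of_int (max 1 \<bar>m\<bar> * max 1 \<bar>n\<bar>) \<le> of_int (m\<^sup>2 + n\<^sup>2)"
      by (simp only: of_int_le_iff)
    hence "max 1 \<bar>real_of_int m\<bar> * max 1 \<bar>real_of_int n\<bar> \<le> (of_int m)\<^sup>2 + (of_int n)\<^sup>2"
      by (simp add: of_int_max)
    hence "((of_int m)\<^sup>2 + (of_int n)\<^sup>2) powr (- \<sigma>) \<le> (max 1 \<bar>real_of_int m\<bar> * max 1 \<bar>real_of_int n\<bar>) powr (- \<sigma>)"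
      using assms by (intro powr_mono2') auto
    thus "norm (case p of (m, n) \<Rightarrow> (of_int (m\<^sup>2 + n\<^sup>2) :: real) powr (- \<sigma>))
            \<le> norm (case p of (m, n) \<Rightarrow> ?u m * ?u n)"
      by (simp add: p powr_mult abs_mult)
  qed
  thus ?thesis by (simp add: case_prod_unfold)
qed

lemma summable_zeta_series:
  assumes "Re s > 1"
  shows "summable (\<lambda>n. of_nat (Suc n) powr (- s))"
proof -
  have "summable (\<lambda>n. exp (of_real (ln (of_nat (Suc n))) * (- s)))"
    unfolding summable_Suc_iff[of "\<lambda>n. exp (of_real (ln (of_nat n)) * (- s))"]
    by (rule summable_complex_powr_iff) (use assms in simp)
  thus ?thesis by (simp add: powr_def mult.commute Ln_of_nat del: of_nat_Suc)
qed

lemma hlawka_zeta_summable: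
  assumes "\<And>\<theta>. r \<theta> > 0" "holder_continuous \<alpha> r" "\<alpha> > 0" "Re s > 1"
  shows "(\<lambda>p. norm (case p of (m, n) \<Rightarrow>
            complex_of_real (r (Arg (Complex (of_int m) (of_int n)))) powr (2 * s)
              * of_real (of_int (m\<^sup>2 + n\<^sup>2)) powr (- s))) summable_on
            ((UNIV :: (int \<times> int) set) - {(0, 0)})"
proof -
  obtain C where C: "\<And>x y. \<bar>r x - r y\<bar> \<le> C * \<bar>x - y\<bar> powr \<alpha>"
    using assms(2) unfolding holder_continuous_def by blast
  define B where "B = r 0 + \<bar>C\<bar> * pi powr \<alpha>"
  have B: "r (Arg z) \<le> B" for z
  proof -
    have "C * \<bar>Arg z\<bar> powr \<alpha> \<le> \<bar>C\<bar> * pi powr \<alpha>"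
      using Arg_bounded[of z] assms(3) by (intro mult_mono powr_mono2) auto
    thus ?thesis using C[of "Arg z" 0] by (simp add: B_def)
  qed
  show ?thesis
  proof (rule Infinite_Sum.abs_summable_on_comparison_test)
    show "(\<lambda>p. norm (case p of (m, n) \<Rightarrow>
             B powr (2 * Re s) * of_int (m\<^sup>2 + n\<^sup>2) powr (- Re s))) summable_on
              ((UNIV :: (int \<times> int) set) - {(0, 0)})"
      using summable_on_cmult_right[OF summable_on_lattice[OF assms(4)], of "B powr (2 * Re s)"]
      by (simp add: case_prod_unfold abs_mult)
  next
    fix p :: "int \<times> int" assume "p \<in> UNIV - {(0, 0)}"
    obtain m n where p: "p = (m, n)" by force
    define t where "t = r (Arg (Complex (of_int m) (of_int n)))"
    define k where "k = m\<^sup>2 + n\<^sup>2"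
    have k: "k \<ge> 0" by (simp add: k_def)
    have t: "0 < t" "t \<le> B" using assms B by (auto simp: t_def)
    have 1: "t powr (2 * Re s) \<le> B powr (2 * Re s)"
      using t assms(4) by (intro powr_mono2) auto
    have 2: "norm (of_real t powr (2 * s)) = t powr (2 * Re s)"
      using t by (subst norm_powr_real_powr) auto
    have 3: "norm (of_real (of_int k) powr (- s)) = of_int k powr (- Re s)"
      using k by (subst norm_powr_real_powr) auto
    have "norm (of_real t powr (2 * s) * of_real (of_int k) powr (- s))
            \<le> norm (B powr (2 * Re s) * of_int k powr (- Re s))"
      unfolding norm_mult 2 3 using 1 by (simp add: mult_right_mono)
    thus "norm (case p of (m, n) \<Rightarrow>
              complex_of_real (r (Arg (Complex (of_int m) (of_int n)))) powr (2 * s)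
                * of_real (of_int (m\<^sup>2 + n\<^sup>2)) powr (- s))
            \<le> norm (case p of (m, n) \<Rightarrow> B powr (2 * Re s) * of_int (m\<^sup>2 + n\<^sup>2) powr (- Re s))"
      by (simp only: p prod.case t_def k_def)
  qed
qed

lemma eisenstein_sharp_summable:
  assumes "Re s > 1"
  shows "(\<lambda>C. norm (iwasawa_fun q s ((SOME \<gamma>. \<gamma> \<in> C) ** mat 1))) summable_on
           (rcosets\<^bsub>SL2Z\<^esub> Gamma_inf_plus)"
proof -
  let ?\<gamma> = "\<lambda>C :: (real^2^2) set. SOME \<gamma>. \<gamma> \<in> C"
  let ?h = "\<lambda>C. (\<lfloor>?\<gamma> C $ 2 $ 1\<rfloor>, \<lfloor>?\<gamma> C $ 2 $ 2\<rfloor>)"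
  let ?Q = "rcosets\<^bsub>SL2Z\<^esub> Gamma_inf_plus"
  let ?L = "\<lambda>p. case p of (m, n) \<Rightarrow> (of_int (m\<^sup>2 + n\<^sup>2) :: real) powr (- Re s)"
  have rep: "det (?\<gamma> C) = 1 \<and> (\<forall>i j. ?\<gamma> C $ i $ j \<in> \<int>) \<and> C = Gamma_inf_plus #>\<^bsub>SL2Z\<^esub> ?\<gamma> C"
    if "C \<in> ?Q" for C
  proof -
    obtain \<gamma> where \<gamma>: "\<gamma> \<in> carrier SL2Z" "C = Gamma_inf_plus #>\<^bsub>SL2Z\<^esub> \<gamma>"
      using \<open>C \<in> ?Q\<close> unfolding RCOSETS_def by blast
    have "?\<gamma> C \<in> C" using coset_self[of \<gamma>] unfolding \<gamma>(2) by (rule someI)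
    then obtain k :: int where k: "?\<gamma> C = mat2 1 (of_int k) 0 1 ** \<gamma>"
      unfolding \<gamma>(2) Gamma_inf_plus_coset by blast
    have shift: "mat2 1 (of_int l) 0 1 ** \<gamma> = mat2 1 (of_int (l - k)) 0 1 ** ?\<gamma> C" for l
      unfolding k by (simp add: mat2_eq_iff matmul2_nth algebra_simps)
    have shift': "mat2 1 (of_int l) 0 1 ** ?\<gamma> C = mat2 1 (of_int (l + k)) 0 1 ** \<gamma>" for l
      unfolding k by (simp add: mat2_eq_iff matmul2_nth algebra_simps)
    have "C = {mat2 1 (of_int l) 0 1 ** \<gamma> | l. True}"
      unfolding \<gamma>(2) Gamma_inf_plus_coset ..
    also have "\<dots> = {mat2 1 (of_int l) 0 1 ** ?\<gamma> C | l. True}"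
      using shift shift' by blast
    also have "\<dots> = Gamma_inf_plus #>\<^bsub>SL2Z\<^esub> ?\<gamma> C"
      unfolding Gamma_inf_plus_coset ..
    finally have 1: "C = Gamma_inf_plus #>\<^bsub>SL2Z\<^esub> ?\<gamma> C" .
    have "det (?\<gamma> C) = 1" "\<forall>i j. ?\<gamma> C $ i $ j \<in> \<int>"
      using \<gamma>(1) by (auto simp: k SL2Z_def SL2R_def det_2 forall_2 matmul2_nth algebra_simps)
    with 1 show ?thesis by blast
  qed
  have row: "of_int (fst (?h C)) = ?\<gamma> C $ 2 $ 1" "of_int (snd (?h C)) = ?\<gamma> C $ 2 $ 2"
    if "C \<in> ?Q" for C
    using rep[OF that] by auto
  have coset_eq: "Gamma_inf_plus #>\<^bsub>SL2Z\<^esub> g \<subseteq> Gamma_inf_plus #>\<^bsub>SL2Z\<^esub> g'"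
    if gg: "det g = 1" "det g' = 1" "\<forall>i j. g $ i $ j \<in> \<int>" "\<forall>i j. g' $ i $ j \<in> \<int>"
      "g$2$1 = g'$2$1" "g$2$2 = g'$2$2" for g g' :: "real^2^2"
  proof
    fix x assume "x \<in> Gamma_inf_plus #>\<^bsub>SL2Z\<^esub> g"
    then obtain l :: int where l: "x = mat2 1 (of_int l) 0 1 ** g"
      unfolding Gamma_inf_plus_coset by blast
    define t where "t = g$1$2 * g'$1$1 - g$1$1 * g'$1$2"
    have "t \<in> \<int>" using gg by (simp add: t_def)
    then obtain k :: int where k: "t = of_int k" by (auto elim: Ints_cases)
    have d: "g$1$1 * g'$2$2 - g$1$2 * g'$2$1 = 1" "g'$1$1 * g'$2$2 - g'$1$2 * g'$2$1 = 1"
      using gg by (simp_all add: det_2)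
    have "g$1$1 = g'$1$1 + t * g'$2$1" "g$1$2 = g'$1$2 + t * g'$2$2"
      using d unfolding t_def by algebra+
    hence "x = mat2 1 (of_int (l + k)) 0 1 ** g'"
      unfolding l using gg(5,6) by (simp add: mat2_eq_iff matmul2_nth k algebra_simps)
    thus "x \<in> Gamma_inf_plus #>\<^bsub>SL2Z\<^esub> g'"
      unfolding Gamma_inf_plus_coset by blast
  qed
  have inj: "inj_on ?h ?Q"
  proof (rule inj_onI)
    fix C D assume CD: "C \<in> ?Q" "D \<in> ?Q" "?h C = ?h D"
    have "?\<gamma> C $ 2 $ 1 = ?\<gamma> D $ 2 $ 1" "?\<gamma> C $ 2 $ 2 = ?\<gamma> D $ 2 $ 2"
      using row[OF CD(1)] row[OF CD(2)] CD(3) by simp_all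
    hence "Gamma_inf_plus #>\<^bsub>SL2Z\<^esub> ?\<gamma> C = Gamma_inf_plus #>\<^bsub>SL2Z\<^esub> ?\<gamma> D"
      using rep[OF CD(1)] rep[OF CD(2)] by (intro equalityI coset_eq) auto
    thus "C = D" using rep[OF CD(1)] rep[OF CD(2)] by simp
  qed
  have sub: "?h ` ?Q \<subseteq> UNIV - {(0, 0)}"
  proof
    fix p assume "p \<in> ?h ` ?Q"
    then obtain C where C: "C \<in> ?Q" and p: "p = ?h C" by blast
    have False if "?h C = (0, 0)"
    proof -
      have "?\<gamma> C $ 2 $ 1 = 0" "?\<gamma> C $ 2 $ 2 = 0" using row[OF C] unfolding that by simp_all
      thus ?thesis using rep[OF C] by (simp add: det_2)
    qed
    thus "p \<in> UNIV - {(0, 0)}" unfolding p by blast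
  qed
  have "?L summable_on ?h ` ?Q"
    using summable_on_lattice[OF assms] sub by (rule summable_on_subset_banach)
  hence "(?L \<circ> ?h) summable_on ?Q"
    using summable_on_reindex[OF inj, of ?L] by blast
  moreover have "norm (iwasawa_fun q s (?\<gamma> C ** mat 1)) = (?L \<circ> ?h) C" if C: "C \<in> ?Q" for C
  proof -
    define c d where "c = ?\<gamma> C $ 2 $ 1" and "d = ?\<gamma> C $ 2 $ 2"
    have cd: "of_int (fst (?h C)) = c" "of_int (snd (?h C)) = d"
      using row[OF C] by (simp_all add: c_def d_def)
    have det: "det (?\<gamma> C) = 1" using rep[OF C] by blast
    hence "Complex d (- c) \<noteq> 0" by (auto simp: det_2 c_def d_def complex_eq_iff)
    hence "norm (sgn (Complex d (- c)) powi q) = 1" by (simp add: norm_power_int norm_sgn)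
    moreover have "norm (of_real (1 / (c\<^sup>2 + d\<^sup>2)) powr s :: complex) = (1 / (c\<^sup>2 + d\<^sup>2)) powr Re s"
      by (subst norm_powr_real_powr) auto
    moreover have "(1 / (c\<^sup>2 + d\<^sup>2)) powr Re s = (c\<^sup>2 + d\<^sup>2) powr (- Re s)"
      by (simp add: powr_minus powr_divide inverse_eq_divide)
    ultimately have "norm (iwasawa_fun q s (?\<gamma> C)) = (c\<^sup>2 + d\<^sup>2) powr (- Re s)"
      unfolding iwasawa_fun_eq[OF det] c_def [symmetric] d_def [symmetric] norm_mult by simp
    also have "\<dots> = (?L \<circ> ?h) C"
      unfolding cd [symmetric] by (simp add: case_prod_unfold)
    finally show ?thesis by simp
  qed
  ultimately show ?thesis
    by (subst summable_on_cong) auto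
qed

end

theory Submission
  imports Defs
begin

text \<open>
  Write \<open>h = r powr (2 s)\<close>, which is Hoelder continuous with the same exponent as \<open>r\<close>, since \<open>r\<close> takes
  values in a compact interval of positive reals.  By Bernstein's theorem its Fourier coefficients are
  absolutely summable: Bessel's inequality for \<open>h(t + d) - h(t)\<close> with \<open>d\<close> of order \<open>1 / 2\<^sup>j\<close>
  and the Cauchy-Schwarz inequality bound the sum over \<open>\<bar>q\<bar>\<close> in the \<open>j\<close>-th dyadic block
  geometrically, because \<open>\<alpha> > 1 / 2\<close>.  Hence the Fourier series converges uniformly; its limit has the
  Fourier coefficients of \<open>h\<close> and therefore equals \<open>h\<close>, by Stone-Weierstrass.

  A coset of \<open>Gamma_inf_plus\<close> is determined by the bottom row of its elements, which can be any coprime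
  pair, and the factor \<open>zeta(2 s)\<close> accounts for the greatest common divisor, so the Eisenstein series
  at the identity is a sum over all nonzero lattice points.  Inserting the Fourier series of \<open>h\<close> into
  the definition of the Hlawka zeta function and exchanging the two absolutely convergent sums gives
  the claim.
\<close>

section \<open>Fourier coefficients and Bessel's inequality\<close>

lemma fourier_coeff_alt:
  "fourier_coeff h q = integral {0..2 * pi} (\<lambda>t. h t * cis (- (of_int q * t))) / (2 * of_real pi)"
  by (simp add: fourier_coeff_def cis_conv_exp mult_ac)

lemma fourier_coeff_add:
  assumes "continuous_on {0..2 * pi} f" "continuous_on {0..2 * pi} g"
  shows "fourier_coeff (\<lambda>t. f t + g t) q = fourier_coeff f q + fourier_coeff g q"
  unfolding fourier_coeff_alt distrib_right add_divide_distrib [symmetric] using assms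
  by (intro arg_cong2[where f = divide] refl integral_add integrable_continuous_real continuous_intros)

lemma fourier_coeff_diff:
  assumes "continuous_on {0..2 * pi} f" "continuous_on {0..2 * pi} g"
  shows "fourier_coeff (\<lambda>t. f t - g t) q = fourier_coeff f q - fourier_coeff g q"
  unfolding fourier_coeff_alt left_diff_distrib diff_divide_distrib [symmetric] using assms
  by (intro arg_cong2[where f = divide] refl integral_diff integrable_continuous_real continuous_intros)

lemma fourier_coeff_cmult: "fourier_coeff (\<lambda>t. c * f t) q = c * fourier_coeff f q"
  unfolding fourier_coeff_alt by (simp add: mult.assoc)

lemma fourier_coeff_sum:
  assumes "finite F" "\<And>i. i \<in> F \<Longrightarrow> continuous_on {0..2 * pi} (f i)"
  shows "fourier_coeff (\<lambda>t. \<Sum>i\<in>F. f i t) q = (\<Sum>i\<in>F. fourier_coeff (f i) q)"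
  using assms
proof (induction rule: finite_induct)
  case empty
  show ?case by (simp add: fourier_coeff_alt)
next
  case (insert i F)
  thus ?case by (simp add: fourier_coeff_add continuous_on_sum)
qed

text \<open>Modulation moves the frequency index. This reduces orthogonality of the characters to
  the coefficients of the constant function, and it handles the degree-one polynomials in the
  uniqueness argument.\<close>

lemma fourier_coeff_mult_cis:
  "fourier_coeff (\<lambda>t. f t * cis (of_int k * t)) q = fourier_coeff f (q - k)"
proof -
  have "cis (of_int k * t) * cis (- (of_int q * t)) = cis (- (of_int (q - k) * t))" for t
    by (simp add: cis_mult algebra_simps)
  thus ?thesis by (simp add: fourier_coeff_alt mult.assoc)
qed

lemma fourier_coeff_const: "fourier_coeff (\<lambda>_. 1) q = (if q = 0 then 1 else 0)"
proof (cases "q = 0")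
  case False
  \<comment> \<open>An antiderivative of the character on the complex plane. Its values at the two
    endpoints agree by periodicity, so the integral vanishes.\<close>
  define G where "G = (\<lambda>z. exp (- \<i> * of_int q * z) / (- \<i> * of_int q))"
  define F where "F = (\<lambda>t::real. G (of_real t))"
  have "((\<lambda>t. cis (- (of_int q * t))) has_integral (F (2 * pi) - F 0)) {0..2 * pi}"
  proof (rule fundamental_theorem_of_calculus)
    fix t :: real
    have "(G has_field_derivative exp (- \<i> * of_int q * of_real t)) (at (of_real t))"
      unfolding G_def using False by (auto intro!: derivative_eq_intros)
    moreover have "exp (- \<i> * of_int q * of_real t) = cis (- (of_int q * t))"
      by (simp add: cis_conv_exp mult_ac)
    ultimately show "(F has_vector_derivative cis (- (of_int q * t))) (at t within {0..2 * pi})"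
      unfolding F_def using has_vector_derivative_real_field by metis
  qed simp
  moreover have "F (2 * pi) = F 0"
    using cis_multiple_2pi[of "of_int (- q)"] by (simp add: F_def G_def cis_conv_exp mult_ac)
  ultimately show ?thesis
    using False by (simp add: fourier_coeff_alt integral_unique)
qed (simp add: fourier_coeff_alt scaleR_conv_of_real)

lemma fourier_coeff_cis: "fourier_coeff (\<lambda>t. cis (of_int k * t)) q = (if q = k then 1 else 0)"
  using fourier_coeff_mult_cis[of "\<lambda>_. 1" k q] by (simp add: fourier_coeff_const)

lemma integral_mult_cnj_cis:
  "integral {0..2 * pi} (\<lambda>t. h t * cnj (c * cis (of_int q * t))) = cnj c * (2 * pi * fourier_coeff h q)"
proof -
  have "(\<lambda>t. h t * cnj (c * cis (of_int q * t))) = (\<lambda>t. cnj c * (h t * cis (- (of_int q * t))))"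
    by (simp add: cis_cnj mult_ac)
  thus ?thesis by (simp add: fourier_coeff_alt)
qed

lemma integral_of_real_continuous:
  fixes h :: "real \<Rightarrow> real"
  assumes "continuous_on {a..b} h"
  shows "integral {a..b} (\<lambda>t. complex_of_real (h t)) = of_real (integral {a..b} h)"
  using integral_linear[OF integrable_continuous_real[OF assms] bounded_linear_of_real]
  by (simp add: o_def)

text \<open>The remainder \<open>g\<close> of the partial sum \<open>P\<close> has vanishing
  coefficients on \<open>F\<close>, hence is orthogonal to \<open>P\<close>. By Pythagoras the
  energy of \<open>g\<close>, which is nonnegative, is the energy of \<open>f\<close> minus the
  contribution of the coefficients.\<close>

lemma bessel_inequality:
  assumes f: "continuous_on {0..2 * pi} f" and F: "finite F"
  shows "(\<Sum>q\<in>F. (cmod (fourier_coeff f q))\<^sup>2) \<le> integral {0..2 * pi} (\<lambda>t. (cmod (f t))\<^sup>2) / (2 * pi)"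
proof -
  define c where "c = fourier_coeff f"
  define P where "P = (\<lambda>t. \<Sum>q\<in>F. c q * cis (of_int q * t))"
  define g where "g = (\<lambda>t. f t - P t)"
  have contP: "continuous_on {0..2 * pi} P" unfolding P_def by (intro continuous_intros)
  have contg: "continuous_on {0..2 * pi} g" unfolding g_def by (intro continuous_intros f contP)
  have int_P: "integral {0..2 * pi} (\<lambda>t. h t * cnj (P t)) = (\<Sum>q\<in>F. cnj (c q) * (2 * pi * fourier_coeff h q))"
    if h: "continuous_on {0..2 * pi} h" for h
  proof -
    have "integral {0..2 * pi} (\<lambda>t. h t * cnj (P t))
            = integral {0..2 * pi} (\<lambda>t. \<Sum>q\<in>F. h t * cnj (c q * cis (of_int q * t)))"
      by (simp add: P_def sum_distrib_left)
    also have "\<dots> = (\<Sum>q\<in>F. integral {0..2 * pi} (\<lambda>t. h t * cnj (c q * cis (of_int q * t))))"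
      using F by (intro integral_sum integrable_continuous_real continuous_intros h)
    finally show ?thesis by (simp only: integral_mult_cnj_cis)
  qed
  have "fourier_coeff P q = c q" if "q \<in> F" for q
    using that F unfolding P_def
    by (subst fourier_coeff_sum) (auto intro!: continuous_intros simp: fourier_coeff_cmult fourier_coeff_cis
          if_distrib sum.delta cong: if_cong)
  hence "fourier_coeff g q = 0" if "q \<in> F" for q
    using that by (simp add: g_def fourier_coeff_diff f contP c_def)
  hence g_P: "integral {0..2 * pi} (\<lambda>t. g t * cnj (P t)) = 0"
    using int_P[OF contg] by simp
  let ?I = "\<lambda>h. integral {0..2 * pi} h :: complex"
  have expand: "(\<lambda>t. h t * cnj (g t)) = (\<lambda>t. h t * cnj (f t) - h t * cnj (P t))" for h :: "real \<Rightarrow> complex"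
    by (simp add: g_def algebra_simps)
  have "?I (\<lambda>t. g t * cnj (g t)) = ?I (\<lambda>t. g t * cnj (f t)) - ?I (\<lambda>t. g t * cnj (P t))"
    unfolding expand by (intro integral_diff integrable_continuous_real continuous_intros f contP contg)
  \<comment> \<open>Orthogonality removes the integral against \<open>P\<close>; conjugation then
    puts \<open>g\<close> into the second factor, where it can be expanded again and
    \<open>int_P\<close> evaluates the part with \<open>f\<close> against \<open>P\<close>.\<close>
  also have "\<dots> = cnj (?I (\<lambda>t. f t * cnj (g t)))"
    unfolding g_P by (simp add: integral_cnj mult.commute)
  also have "?I (\<lambda>t. f t * cnj (g t)) = ?I (\<lambda>t. f t * cnj (f t)) - ?I (\<lambda>t. f t * cnj (P t))"
    unfolding expand by (intro integral_diff integrable_continuous_real continuous_intros f contP)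
  also have "?I (\<lambda>t. f t * cnj (P t)) = of_real (2 * pi * (\<Sum>q\<in>F. (cmod (c q))\<^sup>2))"
    unfolding int_P[OF f] by (simp add: sum_distrib_left c_def mult_ac complex_norm_square del: of_real_power)
  finally have "?I (\<lambda>t. of_real ((cmod (g t))\<^sup>2))
      = cnj (?I (\<lambda>t. of_real ((cmod (f t))\<^sup>2)) - of_real (2 * pi * (\<Sum>q\<in>F. (cmod (c q))\<^sup>2)))"
    by (simp only: complex_norm_square)
  hence "complex_of_real (integral {0..2 * pi} (\<lambda>t. (cmod (g t))\<^sup>2))
      = of_real (integral {0..2 * pi} (\<lambda>t. (cmod (f t))\<^sup>2) - 2 * pi * (\<Sum>q\<in>F. (cmod (c q))\<^sup>2))"
    by (simp only: of_real_diff complex_cnj_diff complex_cnj_complex_of_real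
          integral_of_real_continuous[OF continuous_on_power[OF continuous_on_norm]] f contg)
  hence "integral {0..2 * pi} (\<lambda>t. (cmod (g t))\<^sup>2)
      = integral {0..2 * pi} (\<lambda>t. (cmod (f t))\<^sup>2) - 2 * pi * (\<Sum>q\<in>F. (cmod (c q))\<^sup>2)"
    by (simp only: of_real_eq_iff)
  moreover have "integral {0..2 * pi} (\<lambda>t. (cmod (g t))\<^sup>2) \<ge> 0"
    by (intro integral_nonneg integrable_continuous_real continuous_intros contg) auto
  ultimately show ?thesis by (simp add: c_def field_simps)
qed

text \<open>The translated window is cut at \<open>p\<close>, and the piece beyond \<open>p\<close>
  is moved back by one period.\<close>

lemma integral_periodic_shift:
  fixes f :: "real \<Rightarrow> complex"
  assumes f: "continuous_on UNIV f" and per: "\<And>t. f (t + p) = f t" and d: "0 \<le> d" "d \<le> p"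
  shows "integral {0..p} (\<lambda>t. f (t + d)) = integral {0..p} f"
proof -
  have int: "f integrable_on {a..b}" for a b
    using f by (intro integrable_continuous_real) (rule continuous_on_subset, auto)
  have "integral {0..p} (\<lambda>t. f (t + d)) = integral {d..p + d} f"
    using integral_shift_Icc_real[of 0 p f d] by (simp add: o_def add.commute)
  also have "\<dots> = integral {d..p} f + integral {p..p + d} f"
    using d int by (intro Henstock_Kurzweil_Integration.integral_combine [symmetric]) auto
  also have "integral {p..p + d} f = integral {0..d} (\<lambda>t. f (t + p))"
    using integral_shift_Icc_real[of 0 d f p] by (simp add: o_def add.commute)
  also have "\<dots> = integral {0..d} f" by (simp add: per)
  also have "integral {d..p} f + integral {0..d} f = integral {0..p} f"
    using d int by (subst add.commute) (intro Henstock_Kurzweil_Integration.integral_combine; auto)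
  finally show ?thesis .
qed

lemma fourier_coeff_shift:
  assumes f: "continuous_on UNIV f" and per: "\<And>t. f (t + 2 * pi) = f t" and d: "0 \<le> d" "d \<le> 2 * pi"
  shows "fourier_coeff (\<lambda>t. f (t + d)) q = cis (of_int q * d) * fourier_coeff f q"
proof -
  define g where "g = (\<lambda>t. f t * cis (- (of_int q * t)))"
  have "g (t + 2 * pi) = g t" for t
  proof -
    have "cis (- (of_int q * (t + 2 * pi))) = cis (- (of_int q * t)) * cis (2 * pi * of_int (- q))"
      by (simp only: cis_mult) (simp add: algebra_simps)
    moreover have "cis (2 * pi * of_int (- q)) = 1" by (rule cis_multiple_2pi) simp
    ultimately show ?thesis by (simp only: g_def per mult_1_right)
  qed
  moreover have "continuous_on UNIV g" unfolding g_def by (intro continuous_intros f)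
  ultimately have "integral {0..2 * pi} (\<lambda>t. g (t + d)) = integral {0..2 * pi} g"
    by (intro integral_periodic_shift d)
  moreover have "f (t + d) * cis (- (of_int q * t)) = cis (of_int q * d) * g (t + d)" for t
  proof -
    have "cis (- (of_int q * t)) = cis (of_int q * d) * cis (- (of_int q * (t + d)))"
      by (simp only: cis_mult) (simp add: algebra_simps)
    thus ?thesis by (simp add: g_def)
  qed
  ultimately show ?thesis by (simp only: fourier_coeff_alt integral_mult_right times_divide_eq_right) (simp only: g_def)
qed

section \<open>Fourier series of Hoelder continuous functions\<close>

lemma holder_imp_continuous_on:
  fixes f :: "real \<Rightarrow> complex"
  assumes hol: "\<And>x y. cmod (f x - f y) \<le> K * \<bar>x - y\<bar> powr \<alpha>" and "\<alpha> > 0"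
  shows "continuous_on UNIV f"
  unfolding continuous_on_def
proof safe
  fix x :: real
  have "((\<lambda>y. K * \<bar>y - x\<bar> powr \<alpha>) \<longlongrightarrow> K * \<bar>x - x\<bar> powr \<alpha>) (at x)"
    using \<open>\<alpha> > 0\<close> by (intro tendsto_intros tendsto_powr') auto
  hence "((\<lambda>y. K * \<bar>y - x\<bar> powr \<alpha>) \<longlongrightarrow> 0) (at x)" by simp
  moreover have "\<forall>\<^sub>F y in at x. cmod (f y - f x) \<le> K * \<bar>y - x\<bar> powr \<alpha>"
    by (intro always_eventually allI hol)
  ultimately have "((\<lambda>y. f y - f x) \<longlongrightarrow> 0) (at x)" by (rule Lim_null_comparison[rotated])
  thus "(f \<longlongrightarrow> f x) (at x)" by (simp add: LIM_zero_iff)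
qed

text \<open>The increment of \<open>f\<close> by \<open>d\<close> is at most
  \<open>K * d powr \<alpha>\<close>, which is of order \<open>2 powr (- j * \<alpha>)\<close>.
  Cauchy-Schwarz over at most \<open>2 * 2 ^ j\<close> frequencies costs a factor of order
  \<open>2 powr (j / 2)\<close>. The product gives the ratio
  \<open>2 powr (1 / 2 - \<alpha>)\<close>. Any part \<open>F\<close> of the block is allowed, so
  that partial sums can be cut into blocks.\<close>

lemma sum_fourier_coeff_dyadic_le:
  assumes per: "\<And>t. f (t + 2 * pi) = f t"
    and hol: "\<And>x y. cmod (f x - f y) \<le> K * \<bar>x - y\<bar> powr \<alpha>" and \<alpha>: "\<alpha> > 0"
    and F: "\<And>q. q \<in> F \<Longrightarrow> 2 ^ j \<le> \<bar>q\<bar> \<and> \<bar>q\<bar> < 2 ^ Suc j"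
  shows "(\<Sum>q\<in>F. cmod (fourier_coeff f q)) \<le> K * pi powr \<alpha> * (2 powr (1 / 2 - \<alpha>)) ^ j"
proof -
  have cont: "continuous_on UNIV f" by (rule holder_imp_continuous_on[OF hol \<alpha>])
  have K: "K \<ge> 0" using order_trans[OF norm_ge_zero hol[of 1 0]] by simp
  have sub: "F \<subseteq> {- (2 ^ Suc j)<..- (2 ^ j)} \<union> {2 ^ j..<2 ^ Suc j}" using F by fastforce
  have finF: "finite F" by (rule finite_subset[OF sub]) simp
  have "card F \<le> card ({- (2 ^ Suc j)<..- (2 ^ j)} \<union> {2 ^ j..<2 ^ Suc j :: int})"
    by (rule card_mono[OF _ sub]) simp
  also have "\<dots> \<le> card {- (2 ^ Suc j)<..- (2 ^ j) :: int} + card {2 ^ j..<2 ^ Suc j :: int}"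
    by (rule card_Un_le)
  also have "\<dots> = 2 * 2 ^ j" by (simp add: nat_power_eq)
  finally have "real (card F) \<le> real (2 * 2 ^ j)" by (simp only: of_nat_le_iff)
  hence cardF: "real (card F) \<le> 2 * 2 ^ j" by simp
  txt \<open>Translation by this \<open>d\<close> multiplies the \<open>q\<close>-th coefficient by \<open>cis (q * d)\<close>, which has
    nonpositive real part, and so distance at least \<open>sqrt 2\<close> from \<open>1\<close>, on the whole dyadic block.\<close>
  define d where "d = pi / 2 ^ Suc j"
  have d: "0 < d" "d \<le> 2 * pi"
  proof -
    have "(1::real) \<le> 2 ^ Suc j" by (rule one_le_power) simp
    hence "pi \<le> 2 * pi * 2 ^ Suc j" using pi_gt_zero mult_mono[of 1 2 1 "2 ^ Suc j :: real"]
      by (simp add: field_simps)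
    thus "0 < d" "d \<le> 2 * pi" by (simp_all add: d_def divide_le_eq)
  qed
  define g where "g = (\<lambda>t. f (t + d) - f t)"
  have cont_sh: "continuous_on UNIV (\<lambda>t. f (t + d))"
    by (rule continuous_on_compose2[OF cont]) (auto intro!: continuous_intros)
  have contg: "continuous_on {0..2 * pi} g" unfolding g_def
    using continuous_on_subset[OF cont] continuous_on_subset[OF cont_sh]
    by (intro continuous_intros) auto
  have coeff_g: "fourier_coeff g q = (cis (of_int q * d) - 1) * fourier_coeff f q" for q
    using d fourier_coeff_shift[OF cont per, of d q] continuous_on_subset[OF cont] continuous_on_subset[OF cont_sh]
    unfolding g_def by (subst fourier_coeff_diff) (auto simp: algebra_simps)
  have coeff_le: "2 * (cmod (fourier_coeff f q))\<^sup>2 \<le> (cmod (fourier_coeff g q))\<^sup>2" if "q \<in> F" for q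
  proof -
    have "real_of_int (2 ^ j) \<le> \<bar>of_int q\<bar>" "\<bar>of_int q\<bar> \<le> real_of_int (2 ^ Suc j)"
      unfolding of_int_abs [symmetric] of_int_le_iff using F[OF that] by (blast intro: less_imp_le)+
    hence "2 ^ j * d \<le> \<bar>of_int q\<bar> * d" "\<bar>of_int q\<bar> * d \<le> 2 ^ Suc j * d"
      using d by (auto intro!: mult_right_mono)
    hence "pi / 2 \<le> \<bar>of_int q\<bar> * d" "\<bar>of_int q\<bar> * d \<le> pi"
      by (simp_all add: d_def)
    hence "cos (\<bar>of_int q\<bar> * d) \<le> cos (pi / 2)" by (intro cos_monotone_0_pi_le) auto
    moreover have "cos (\<bar>of_int q\<bar> * d) = cos (of_int q * d)" by (simp add: abs_if)
    ultimately have "cos (of_int q * d) \<le> 0" by simp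
    moreover have "(cmod (cis x - 1))\<^sup>2 = 2 - 2 * cos x" for x
    proof -
      have "(cmod (cis x - 1))\<^sup>2 = (cos x)\<^sup>2 + (sin x)\<^sup>2 + 1 - 2 * cos x"
        unfolding cmod_power2 by (simp add: power2_eq_square algebra_simps)
      thus ?thesis by simp
    qed
    ultimately have "2 \<le> (cmod (cis (of_int q * d) - 1))\<^sup>2" by simp
    thus ?thesis unfolding coeff_g norm_mult power_mult_distrib by (intro mult_right_mono) auto
  qed
  let ?D = "(K * d powr \<alpha>)\<^sup>2"
  have "integral {0..2 * pi} (\<lambda>t. (cmod (g t))\<^sup>2) \<le> integral {0..2 * pi} (\<lambda>_. ?D)"
  proof (intro integral_le integrable_continuous_real continuous_intros contg)
    fix t :: real
    have "cmod (g t) \<le> K * d powr \<alpha>" using hol[of "t + d" t] d by (simp add: g_def)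
    thus "(cmod (g t))\<^sup>2 \<le> ?D" by (intro power_mono) auto
  qed
  hence "integral {0..2 * pi} (\<lambda>t. (cmod (g t))\<^sup>2) / (2 * pi) \<le> ?D" by (simp add: field_simps)
  with bessel_inequality[OF contg finF] have "(\<Sum>q\<in>F. (cmod (fourier_coeff g q))\<^sup>2) \<le> ?D" by linarith
  moreover have "(\<Sum>q\<in>F. 2 * (cmod (fourier_coeff f q))\<^sup>2) \<le> (\<Sum>q\<in>F. (cmod (fourier_coeff g q))\<^sup>2)"
    by (intro sum_mono coeff_le)
  ultimately have energy: "2 * (\<Sum>q\<in>F. (cmod (fourier_coeff f q))\<^sup>2) \<le> ?D"
    by (simp add: sum_distrib_left)
  \<comment> \<open>The factor 2 in the bound for the cardinality cancels the factor 2 in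
    \<open>energy\<close>.\<close>
  have "(\<Sum>q\<in>F. cmod (fourier_coeff f q))\<^sup>2 \<le> (\<Sum>q\<in>F. (cmod (fourier_coeff f q))\<^sup>2) * real (card F)"
    using Cauchy_Schwarz_ineq_sum[of "\<lambda>q. cmod (fourier_coeff f q)" "\<lambda>_. 1" F] by simp
  also have "\<dots> \<le> (\<Sum>q\<in>F. (cmod (fourier_coeff f q))\<^sup>2) * (2 * 2 ^ j)"
    by (intro mult_left_mono cardF sum_nonneg) auto
  also have "\<dots> \<le> ?D * 2 ^ j" using energy by simp
  also have "\<dots> = (K * d powr \<alpha> * 2 powr (real j / 2))\<^sup>2"
    by (simp add: power_mult_distrib powr_power powr_realpow)
  finally have "(\<Sum>q\<in>F. cmod (fourier_coeff f q)) \<le> K * d powr \<alpha> * 2 powr (real j / 2)"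
    by (rule power2_le_imp_le) (use K in auto)
  \<comment> \<open>Doubling \<open>d\<close> is harmless and makes the bound an exact geometric
    term.\<close>
  also have "\<dots> \<le> K * (pi / 2 ^ j) powr \<alpha> * 2 powr (real j / 2)"
  proof (intro mult_right_mono mult_left_mono powr_mono2)
    show "d \<le> pi / 2 ^ j" unfolding d_def by (intro divide_left_mono) auto
  qed (use d K \<alpha> in auto)
  also have "(pi / 2 ^ j) powr \<alpha> = pi powr \<alpha> * 2 powr (- (real j * \<alpha>))"
  proof -
    have "(2 ^ j) powr \<alpha> = (2 powr real j) powr \<alpha>" by (simp add: powr_realpow)
    also have "\<dots> = 2 powr (real j * \<alpha>)" by (rule powr_powr)
    finally show ?thesis by (simp add: powr_divide powr_minus_divide)
  qed
  also have "K * (pi powr \<alpha> * 2 powr (- (real j * \<alpha>))) * 2 powr (real j / 2)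
      = K * pi powr \<alpha> * (2 powr (1 / 2 - \<alpha>)) ^ j"
  proof -
    have "(2 powr (1 / 2 - \<alpha>)) ^ j = 2 powr (- (real j * \<alpha>) + real j / 2)"
      by (simp add: powr_power) (simp add: algebra_simps)
    thus ?thesis by (simp only: powr_add mult.assoc)
  qed
  finally show ?thesis .
qed

text \<open>A finite partial sum is grouped by the dyadic block \<open>J q\<close>. The block bounds
  form a geometric series whose ratio is below 1 precisely because \<alpha> exceeds one half, so all
  partial sums have a common bound.\<close>

lemma summable_fourier_coeff_holder:
  assumes per: "\<And>t. f (t + 2 * pi) = f t"
    and hol: "\<And>x y. cmod (f x - f y) \<le> K * \<bar>x - y\<bar> powr \<alpha>" and \<alpha>: "\<alpha> > 1 / 2"
  shows "(\<lambda>q. cmod (fourier_coeff f q)) summable_on UNIV"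
proof (rule nonneg_bdd_above_summable_on)
  define \<rho> :: real where "\<rho> = 2 powr (1 / 2 - \<alpha>)"
  have "\<rho> < 2 powr 0" unfolding \<rho>_def by (rule powr_less_mono) (use \<alpha> in linarith, simp)
  hence \<rho>: "0 \<le> \<rho>" "\<rho> < 1" by (simp_all add: \<rho>_def del: powr_less_one)
  define D where "D = K * pi powr \<alpha>"
  have "K \<ge> 0" using order_trans[OF norm_ge_zero hol[of 1 0]] by simp
  hence D: "D \<ge> 0" unfolding D_def by (rule mult_nonneg_nonneg) (rule powr_ge_zero)
  let ?c = "\<lambda>q. cmod (fourier_coeff f q)"
  have "\<exists>j. 2 ^ j \<le> \<bar>q\<bar> \<and> \<bar>q\<bar> < 2 ^ Suc j" if "q \<noteq> 0" for q :: int
  proof -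
    have "1 \<le> nat \<bar>q\<bar>" using that by linarith
    then obtain n where "2 ^ n \<le> nat \<bar>q\<bar>" "nat \<bar>q\<bar> < 2 ^ (n + 1)"
      using ex_power_ivl1[OF order_refl[of 2], of "nat \<bar>q\<bar>"] by blast
    hence "int (2 ^ n) \<le> int (nat \<bar>q\<bar>)" "int (nat \<bar>q\<bar>) < int (2 ^ (n + 1))" by (simp_all only: of_nat_le_iff of_nat_less_iff)
    thus ?thesis by (intro exI[of _ n]) simp
  qed
  note ex = this
  define J where "J = (\<lambda>q::int. SOME j. 2 ^ j \<le> \<bar>q\<bar> \<and> \<bar>q\<bar> < 2 ^ Suc j)"
  have J: "2 ^ J q \<le> \<bar>q\<bar> \<and> \<bar>q\<bar> < 2 ^ Suc (J q)" if "q \<noteq> 0" for q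
    unfolding J_def by (rule someI_ex[OF ex[OF that]])
  have "sum ?c F \<le> ?c 0 + D * (\<Sum>j. \<rho> ^ j)" if "finite F" for F
  proof -
    \<comment> \<open>Frequency 0 lies in no dyadic block and is split off.\<close>
    have "sum ?c F \<le> ?c 0 + sum ?c (F - {0})"
      using sum.remove[of F 0 ?c] that by (cases "0 \<in> F") simp_all
    also have "sum ?c (F - {0}) = (\<Sum>j\<in>J ` (F - {0}). sum ?c {q \<in> F - {0}. J q = j})"
      using that by (intro sum.group [symmetric]) auto
    also have "\<dots> \<le> (\<Sum>j\<in>J ` (F - {0}). D * \<rho> ^ j)"
      unfolding D_def \<rho>_def using J \<alpha>
      by (intro sum_mono sum_fourier_coeff_dyadic_le[where f = f, OF per hol]) auto
    also have "\<dots> = D * (\<Sum>j\<in>J ` (F - {0}). \<rho> ^ j)" by (simp add: sum_distrib_left)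
    also have "\<dots> \<le> D * (\<Sum>j. \<rho> ^ j)"
      using that \<rho> D by (intro mult_left_mono sum_le_suminf summable_geometric) auto
    finally show ?thesis by simp
  qed
  thus "bdd_above (sum ?c ` {F. F \<subseteq> UNIV \<and> finite F})" by (intro bdd_aboveI2) auto
qed simp

section \<open>Uniqueness of Fourier coefficients and pointwise convergence\<close>

lemma periodic_cis_eq:
  assumes per: "\<And>t. f (t + 2 * pi) = f t" and "cis x = cis y"
  shows "f x = f y"
proof -
  interpret periodic_fun_simple f "2 * pi" by standard (rule per)
  have "sin x = sin y \<and> cos x = cos y" using assms(2) by (simp add: complex_eq_iff)
  then obtain n :: int where "x = y + 2 * pi * of_int n" unfolding sin_cos_eq_iff by blast
  thus ?thesis using plus_of_int[of y n] by (simp add: mult_ac)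
qed

lemma cis_Arg2pi: "z \<noteq> 0 \<Longrightarrow> cis (Arg2pi z) = sgn z"
  using Arg2pi_eq[of z] by (metis cis_conv_exp nonzero_mult_div_cancel_left norm_eq_zero of_real_eq_0_iff sgn_eq)

text \<open>\<open>Arg\<close> jumps only across the negative real axis and \<open>Arg2pi\<close>
  only across the positive one. A periodic function does not distinguish the two, so near each point
  of the circle the continuous branch can be used.\<close>

lemma continuous_on_sphere_Arg:
  fixes f :: "real \<Rightarrow> complex"
  assumes cont: "continuous_on UNIV f" and per: "\<And>t. f (t + 2 * pi) = f t"
  shows "continuous_on (sphere 0 1) (\<lambda>z. f (Arg z))"
proof (rule continuous_at_imp_continuous_on, safe)
  fix z :: complex assume "z \<in> sphere 0 1"
  hence z: "z \<noteq> 0" by auto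
  have isf: "isCont f t" for t using cont by (simp add: continuous_on_eq_continuous_at)
  show "isCont (\<lambda>z. f (Arg z)) z"
  proof (cases "z \<in> \<real>\<^sub>\<le>\<^sub>0")
    case False
    show ?thesis by (rule isCont_o2[OF continuous_at_Arg[OF False] isf])
  next
    case True
    hence "z \<notin> \<real>\<^sub>\<ge>\<^sub>0" using z by (auto simp: complex_nonpos_Reals_iff complex_nonneg_Reals_iff complex_eq_iff)
    hence "isCont (\<lambda>z. f (Arg2pi z)) z" by (intro isCont_o2[OF continuous_at_Arg2pi isf])
    moreover have "\<forall>\<^sub>F w in nhds z. f (Arg w) = f (Arg2pi w)"
    proof -
      have "\<forall>\<^sub>F w in nhds z. w \<noteq> 0" using z by (rule t1_space_nhds)
      thus ?thesis
      proof eventually_elim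
        case (elim w)
        hence "cis (Arg w) = cis (Arg2pi w)" by (simp add: cis_Arg cis_Arg2pi)
        thus ?case by (rule periodic_cis_eq[of f, OF per])
      qed
    qed
    ultimately show ?thesis by (subst isCont_cong) auto
  qed
qed

lemma continuous_on_polynomial_cis:
  fixes p :: "complex \<Rightarrow> real"
  assumes "real_polynomial_function p"
  shows "continuous_on S (\<lambda>t. p (cis t))"
proof (rule continuous_on_compose2[of UNIV p S cis])
  show "continuous_on UNIV p"
    using assms by (intro continuous_on_polymonial_function) (simp only: real_polynomial_function_eq)
qed (auto intro!: continuous_intros)

text \<open>
  Keeping \<open>f\<close> arbitrary in the induction reduces the case of a product of polynomials to two
  applications of the induction hypotheses.
\<close>

lemma fourier_coeff_zero_mult_polynomial:
  fixes p :: "complex \<Rightarrow> real"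
  assumes "real_polynomial_function p"
    and "continuous_on {0..2 * pi} f" "\<And>q. fourier_coeff f q = 0"
  shows "fourier_coeff (\<lambda>t. f t * of_real (p (cis t))) q = 0"
  using assms
proof (induction arbitrary: f q)
  case (linear p)
  interpret bounded_linear p by fact
  define a b where "a = complex_of_real (p 1)" and "b = complex_of_real (p \<i>)"
  \<comment> \<open>A real-linear functional on the plane is determined by its values at 1 and
    \<open>\<i>\<close>; Euler's formulas turn its restriction to the circle into a combination of
    the frequencies 1 and -1.\<close>
  have "complex_of_real (p (cis t)) = (a - \<i> * b) / 2 * cis (of_int 1 * t) + (a + \<i> * b) / 2 * cis (of_int (-1) * t)" for t
  proof -
    have "cis t = cos t *\<^sub>R 1 + sin t *\<^sub>R \<i>" by (simp add: complex_eq_iff)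
    hence "p (cis t) = cos t * p 1 + sin t * p \<i>" by (simp only: add scale real_scaleR_def)
    thus ?thesis by (simp add: a_def b_def complex_eq_iff field_simps)
  qed
  hence "(\<lambda>t. f t * of_real (p (cis t))) = (\<lambda>t. (a - \<i> * b) / 2 * (f t * cis (of_int 1 * t))
            + (a + \<i> * b) / 2 * (f t * cis (of_int (-1) * t)))"
    by (simp add: distrib_left mult.left_commute del: minus_mult_minus)
  moreover have "continuous_on {0..2 * pi} (\<lambda>t. c * (f t * cis (of_int k * t)))" for c and k :: int
    using linear.prems(1) by (intro continuous_intros)
  ultimately show ?case
    by (simp only: fourier_coeff_add fourier_coeff_cmult fourier_coeff_mult_cis linear.prems(2)) simp
next
  case (const c)
  thus ?case using fourier_coeff_cmult[of "of_real c" f q] by (simp add: mult.commute)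
next
  case (add p1 p2)
  have "continuous_on {0..2 * pi} (\<lambda>t. f t * complex_of_real (p (cis t)))" if "real_polynomial_function p" for p
    using that add.prems(1) by (intro continuous_intros continuous_on_polynomial_cis)
  thus ?case using add.hyps add.IH add.prems by (simp add: distrib_left fourier_coeff_add)
next
  case (mult p1 p2)
  have "fourier_coeff (\<lambda>t. (f t * of_real (p1 (cis t))) * of_real (p2 (cis t))) q = 0"
    using mult.hyps by (intro mult.IH continuous_intros continuous_on_polynomial_cis mult.prems)
  thus ?case by (simp add: mult.assoc)
qed

text \<open>Such an \<open>f\<close> integrates to zero against every polynomial in
  \<open>cis t\<close>. Approximating \<open>cnj (f t)\<close> uniformly by such polynomials shows
  that the energy of \<open>f\<close> is arbitrarily small, and continuity then forces
  \<open>f\<close> to vanish.\<close>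

lemma fourier_coeff_zero_imp_zero:
  assumes cont: "continuous_on UNIV f" and per: "\<And>t. f (t + 2 * pi) = f t"
    and zero: "\<And>q. fourier_coeff f q = 0"
  shows "f t = 0"
proof -
  have contf: "continuous_on {0..2 * pi} f" using cont by (rule continuous_on_subset) simp
  have "bounded (f ` {0..2 * pi})"
    by (intro compact_imp_bounded compact_continuous_image contf) simp
  then obtain M where M: "M > 0" "\<And>t. t \<in> {0..2 * pi} \<Longrightarrow> cmod (f t) \<le> M"
    unfolding bounded_pos by blast
  define I where "I = integral {0..2 * pi} (\<lambda>t. (cmod (f t))\<^sup>2)"
  have "I \<ge> 0" unfolding I_def
    by (intro integral_nonneg integrable_continuous_real continuous_intros contf) simp
  have "I \<le> 0 + e" if "e > 0" for e
  proof -
    \<comment> \<open>Chosen so that the final bound \<open>M * d * (2 * pi)\<close> equals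
      \<open>e\<close>.\<close>
    define d where "d = e / (2 * pi * M)"
    have "d > 0" using that M by (simp add: d_def)
    have "continuous_on (sphere 0 1) (\<lambda>z. cnj (f (Arg z)))"
      by (intro continuous_on_cnj continuous_on_sphere_Arg cont per)
    then obtain g where g: "polynomial_function g"
        "\<And>z. z \<in> sphere 0 1 \<Longrightarrow> cmod (cnj (f (Arg z)) - g z) < d"
      using Stone_Weierstrass_polynomial_function[of "sphere 0 1" "\<lambda>z. cnj (f (Arg z))" d] \<open>d > 0\<close>
      by auto
    have close: "cmod (cnj (f t) - g (cis t)) \<le> d" for t
    proof -
      have "f (Arg (cis t)) = f t" by (rule periodic_cis_eq[where f = f, OF per]) (simp add: cis_Arg sgn_eq)
      thus ?thesis using g(2)[of "cis t"] by simp
    qed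
    have poly: "real_polynomial_function (\<lambda>z. Re (g z))" "real_polynomial_function (\<lambda>z. Im (g z))"
      using g(1) bounded_linear_Re bounded_linear_Im unfolding polynomial_function_def o_def by blast+
    have contg: "continuous_on {0..2 * pi} (\<lambda>t. f t * of_real (Re (g (cis t))))"
      "continuous_on {0..2 * pi} (\<lambda>t. \<i> * (f t * of_real (Im (g (cis t)))))"
      by (intro continuous_intros contf continuous_on_polynomial_cis[OF poly(1)]
          continuous_on_polynomial_cis[OF poly(2)])+
    have split: "(\<lambda>t. f t * of_real (Re (g (cis t))) + \<i> * (f t * of_real (Im (g (cis t)))))
        = (\<lambda>t. f t * g (cis t))"
      by (rule ext) (subst (5) complex_eq, simp add: algebra_simps)
    have "fourier_coeff (\<lambda>t. f t * g (cis t)) 0 = 0"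
      unfolding split [symmetric] fourier_coeff_add[OF contg] fourier_coeff_cmult
        fourier_coeff_zero_mult_polynomial[OF poly(1) contf zero]
        fourier_coeff_zero_mult_polynomial[OF poly(2) contf zero] by simp
    hence zero_g: "integral {0..2 * pi} (\<lambda>t. f t * g (cis t)) = 0" by (simp add: fourier_coeff_alt)
    have contfg: "continuous_on {0..2 * pi} (\<lambda>t. f t * g (cis t))"
      using continuous_on_add[OF contg] by (simp only: split)
    have "complex_of_real I = integral {0..2 * pi} (\<lambda>t. f t * cnj (f t))"
      unfolding I_def complex_norm_square [symmetric]
      by (intro integral_of_real_continuous [symmetric] continuous_intros contf)
    \<comment> \<open>Subtracting an integral that is zero exposes the approximation error.\<close>
    also have "\<dots> = integral {0..2 * pi} (\<lambda>t. f t * cnj (f t) - f t * g (cis t))"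
      by (subst integral_diff) (auto intro!: integrable_continuous_real continuous_intros contf contfg simp: zero_g)
    also have "cmod \<dots> \<le> M * d * (2 * pi - 0)"
    proof (rule integral_bound)
      show "continuous_on {0..2 * pi} (\<lambda>t. f t * cnj (f t) - f t * g (cis t))"
        by (intro continuous_intros contf contfg)
      fix t assume "t \<in> {0..2 * pi}"
      thus "cmod (f t * cnj (f t) - f t * g (cis t)) \<le> M * d"
        unfolding right_diff_distrib [symmetric] norm_mult using M close \<open>d > 0\<close>
        by (intro mult_mono) auto
    qed simp
    also have "\<dots> = e" using M by (simp add: d_def)
    finally show ?thesis using \<open>I \<ge> 0\<close> by simp
  qed
  hence "I \<le> 0" by (rule field_le_epsilon)
  with \<open>I \<ge> 0\<close> have "integral {0..2 * pi} (\<lambda>t. (cmod (f t))\<^sup>2) = 0" by (simp add: I_def)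
  hence "\<forall>t\<in>{0..2 * pi}. (cmod (f t))\<^sup>2 = 0"
    by (subst (asm) integral_eq_0_iff) (auto intro!: continuous_intros contf)
  \<comment> \<open>Vanishing is known only on one period; \<open>Arg2pi\<close> supplies the
    representative of \<open>t\<close> there.\<close>
  hence "f (Arg2pi (cis t)) = 0" using Arg2pi_ge_0[of "cis t"] Arg2pi_lt_2pi[of "cis t"] by simp
  moreover have "f (Arg2pi (cis t)) = f t"
    by (rule periodic_cis_eq[where f = f, OF per]) (simp add: cis_Arg2pi sgn_eq)
  ultimately show ?thesis by simp
qed

text \<open>By the Weierstrass M-test the series converges uniformly to a continuous periodic
  \<open>S\<close>. Integrating term by term gives \<open>S\<close> the coefficients of
  \<open>f\<close>, so uniqueness applies to the difference.\<close>

lemma fourier_series_has_sum: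
  assumes cont: "continuous_on UNIV f" and per: "\<And>t. f (t + 2 * pi) = f t"
    and summable: "(\<lambda>q. cmod (fourier_coeff f q)) summable_on UNIV"
  shows "((\<lambda>q. fourier_coeff f q * cis (of_int q * t)) has_sum f t) UNIV"
proof -
  define c where "c = fourier_coeff f"
  define S where "S = (\<lambda>t. \<Sum>\<^sub>\<infinity>q. c q * cis (of_int q * t))"
  \<comment> \<open>One statement serves twice: \<open>p = 0\<close> gives continuity of
    \<open>S\<close>, and general \<open>p\<close> allows the limit to pass under the integral
    defining a coefficient.\<close>
  have unif: "uniform_limit UNIV (\<lambda>X t. (\<Sum>q\<in>X. c q * cis (of_int q * t)) * cis (- (of_int p * t)))
      (\<lambda>t. S t * cis (- (of_int p * t))) (finite_subsets_at_top UNIV)" for p :: int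
  proof -
    have "uniform_limit UNIV (\<lambda>X t. \<Sum>q\<in>X. c q * cis (of_int q * t) * cis (- (of_int p * t)))
      (\<lambda>t. \<Sum>\<^sub>\<infinity>q. c q * cis (of_int q * t) * cis (- (of_int p * t))) (finite_subsets_at_top UNIV)"
      by (rule Weierstrass_m_test_general[where M = "\<lambda>q. cmod (c q)"])
         (use summable in \<open>simp_all add: c_def norm_mult\<close>)
    thus ?thesis by (simp add: S_def infsum_cmult_left' sum_distrib_right)
  qed
  have contS: "continuous_on UNIV S"
  proof (rule uniform_limit_theorem)
    show "uniform_limit UNIV (\<lambda>X t. \<Sum>q\<in>X. c q * cis (of_int q * t)) S (finite_subsets_at_top UNIV)"
      using unif[of 0] by simp
  qed (auto intro!: always_eventually continuous_intros)
  have perS: "S (t + 2 * pi) = S t" for t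
  proof -
    have "cis (of_int q * (t + 2 * pi)) = cis (of_int q * t)" for q
    proof -
      have "cis (of_int q * (t + 2 * pi)) = cis (of_int q * t) * cis (2 * pi * of_int q)"
        by (simp only: cis_mult) (simp add: algebra_simps)
      thus ?thesis by (simp add: cis_multiple_2pi)
    qed
    thus ?thesis by (simp add: S_def)
  qed
  have coeffS: "fourier_coeff S p = c p" for p
  proof -
    obtain I J where IJ: "\<And>X. ((\<lambda>t. (\<Sum>q\<in>X. c q * cis (of_int q * t)) * cis (- (of_int p * t))) has_integral I X) {0..2 * pi}"
        "((\<lambda>t. S t * cis (- (of_int p * t))) has_integral J) {0..2 * pi}"
        "(I \<longlongrightarrow> J) (finite_subsets_at_top UNIV)"
      by (rule uniform_limit_integral[OF uniform_limit_on_subset[OF unif]])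
         (auto intro!: continuous_intros)
    \<comment> \<open>By orthogonality the integrals are constant once the finite set contains
      \<open>p\<close>, which determines their limit \<open>J\<close>.\<close>
    have "I X = c p * (2 * pi)" if "finite X" "p \<in> X" for X
    proof -
      have "fourier_coeff (\<lambda>t. \<Sum>q\<in>X. c q * cis (of_int q * t)) p = c p"
        using that by (subst fourier_coeff_sum) (auto intro!: continuous_intros
            simp: fourier_coeff_cmult fourier_coeff_cis if_distrib sum.delta cong: if_cong)
      thus ?thesis unfolding fourier_coeff_alt integral_unique[OF IJ(1)] by (simp add: field_simps)
    qed
    hence "\<forall>\<^sub>F X in finite_subsets_at_top UNIV. I X = c p * (2 * pi)"
      by (intro eventually_finite_subsets_at_top[THEN iffD2] exI[of _ "{p}"]) auto
    hence "(I \<longlongrightarrow> c p * (2 * pi)) (finite_subsets_at_top UNIV)" by (rule tendsto_eventually)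
    with IJ(3) have "J = c p * (2 * pi)"
      by (intro tendsto_unique[OF finite_subsets_at_top_neq_bot])
    thus ?thesis unfolding fourier_coeff_alt integral_unique[OF IJ(2)] by simp
  qed
  have "f t - S t = 0"
  proof (rule fourier_coeff_zero_imp_zero[where f = "\<lambda>t. f t - S t"])
    show "fourier_coeff (\<lambda>t. f t - S t) q = 0" for q
      using continuous_on_subset[OF cont] continuous_on_subset[OF contS]
      by (subst fourier_coeff_diff) (auto simp: coeffS c_def)
  qed (auto intro!: continuous_intros cont contS simp: per perS)
  moreover have "(\<lambda>q. c q * cis (of_int q * t)) summable_on UNIV"
    by (rule abs_summable_summable) (use summable in \<open>simp add: c_def norm_mult\<close>)
  hence "((\<lambda>q. c q * cis (of_int q * t)) has_sum S t) UNIV" unfolding S_def by (rule has_sum_infsum)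
  ultimately show ?thesis by (simp add: c_def)
qed

section \<open>The Eisenstein series as a lattice sum\<close>

lemma SL2Z_iff: "\<gamma> \<in> carrier SL2Z \<longleftrightarrow> det \<gamma> = 1 \<and> (\<forall>i j. \<gamma> $ i $ j \<in> \<int>)"
  by (simp add: SL2Z_def SL2R_def)

lemma Gamma_inf_plus_coset_eq_bottom_row:
  assumes \<gamma>: "\<gamma> \<in> carrier SL2Z"
  shows "Gamma_inf_plus #>\<^bsub>SL2Z\<^esub> \<gamma> = {\<gamma>' \<in> carrier SL2Z. \<gamma>' $ 2 = \<gamma> $ 2}"
proof (intro equalityI subsetI CollectI conjI)
  fix \<gamma>' assume *: "\<gamma>' \<in> Gamma_inf_plus #>\<^bsub>SL2Z\<^esub> \<gamma>"
  show "\<gamma>' $ 2 = \<gamma> $ 2" by (rule coset_bottom_row[OF *])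
  obtain k :: int where k: "\<gamma>' = mat2 1 (of_int k) 0 1 ** \<gamma>"
    using * unfolding Gamma_inf_plus_coset by blast
  have "\<gamma>' $ i $ j \<in> \<int>" for i j
    using \<gamma> exhaust_2[of i] exhaust_2[of j] by (auto simp: SL2Z_iff k matmul2_nth)
  thus "\<gamma>' \<in> carrier SL2Z"
    using \<gamma> coset_bottom_row(2)[OF *] by (simp add: SL2Z_iff)
next
  fix \<gamma>' assume "\<gamma>' \<in> {\<gamma>' \<in> carrier SL2Z. \<gamma>' $ 2 = \<gamma> $ 2}"
  hence \<gamma>': "det \<gamma>' = 1" "\<And>i j. \<gamma>' $ i $ j \<in> \<int>" and row: "\<gamma>' $ 2 = \<gamma> $ 2"
    by (auto simp: SL2Z_iff)
  \<comment> \<open>The upper right entry of \<open>\<gamma>'\<close> times the inverse of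
    \<open>\<gamma>\<close>; that product is the required unipotent matrix.\<close>
  define t where "t = \<gamma>'$1$2 * \<gamma>$1$1 - \<gamma>'$1$1 * \<gamma>$1$2"
  have "t \<in> \<int>" using \<gamma> \<gamma>' by (simp add: t_def SL2Z_iff)
  then obtain k where k: "t = of_int k" by (auto elim: Ints_cases)
  have d: "\<gamma>'$1$1 * \<gamma>$2$2 - \<gamma>'$1$2 * \<gamma>$2$1 = 1" "\<gamma>$1$1 * \<gamma>$2$2 - \<gamma>$1$2 * \<gamma>$2$1 = 1"
    using \<gamma> \<gamma>' row by (simp_all add: SL2Z_iff det_2)
  have "\<gamma>'$1$1 = \<gamma>$1$1 + t * \<gamma>$2$1" "\<gamma>'$1$2 = \<gamma>$1$2 + t * \<gamma>$2$2"
    using d unfolding t_def by algebra+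
  hence "\<gamma>' = mat2 1 (of_int k) 0 1 ** \<gamma>"
    using row by (simp add: mat2_eq_iff matmul2_nth k)
  thus "\<gamma>' \<in> Gamma_inf_plus #>\<^bsub>SL2Z\<^esub> \<gamma>" unfolding Gamma_inf_plus_coset by blast
qed

definition bottom_row_fibre :: "int \<times> int \<Rightarrow> (real ^ 2 ^ 2) set" where
  "bottom_row_fibre p = {\<gamma> \<in> carrier SL2Z. \<gamma> $ 2 $ 1 = of_int (fst p) \<and> \<gamma> $ 2 $ 2 = of_int (snd p)}"

lemma bottom_row_fibre_nonempty:
  assumes "coprime (fst p) (snd p)"
  shows "bottom_row_fibre p \<noteq> {}"
proof -
  obtain u v where "u * fst p + v * snd p = 1"
    using bezout_int[of "fst p" "snd p"] assms by auto
  hence "real_of_int (u * fst p + v * snd p) = 1" by simp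
  \<comment> \<open>The Bezout identity is the determinant condition for this top row.\<close>
  hence "mat2 (of_int v) (of_int (- u)) (of_int (fst p)) (of_int (snd p)) \<in> bottom_row_fibre p"
    by (simp add: bottom_row_fibre_def SL2Z_iff det_2 forall_2 algebra_simps)
  thus ?thesis by blast
qed

lemma coset_eq_bottom_row_fibre:
  assumes "\<gamma> \<in> bottom_row_fibre p"
  shows "Gamma_inf_plus #>\<^bsub>SL2Z\<^esub> \<gamma> = bottom_row_fibre p"
proof -
  have "\<gamma> \<in> carrier SL2Z" using assms by (simp add: bottom_row_fibre_def)
  thus ?thesis using assms
    by (auto simp: Gamma_inf_plus_coset_eq_bottom_row bottom_row_fibre_def vec_eq_iff[of "_ $ 2"] forall_2)
qed

lemma bij_betw_bottom_row_fibre: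
  "bij_betw bottom_row_fibre {p. coprime (fst p) (snd p)} (rcosets\<^bsub>SL2Z\<^esub> Gamma_inf_plus)"
  unfolding bij_betw_def
proof (intro conjI equalityI subsetI inj_onI)
  fix p p' :: "int \<times> int"
  assume p: "p \<in> {p. coprime (fst p) (snd p)}" and eq: "bottom_row_fibre p = bottom_row_fibre p'"
  then obtain \<gamma> where "\<gamma> \<in> bottom_row_fibre p" using bottom_row_fibre_nonempty by blast
  with eq show "p = p'" by (auto simp: bottom_row_fibre_def prod_eq_iff)
next
  fix C assume "C \<in> bottom_row_fibre ` {p. coprime (fst p) (snd p)}"
  then obtain p where p: "coprime (fst p) (snd p)" "C = bottom_row_fibre p" by blast
  then obtain \<gamma> where \<gamma>: "\<gamma> \<in> bottom_row_fibre p" using bottom_row_fibre_nonempty by blast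
  hence "C = Gamma_inf_plus #>\<^bsub>SL2Z\<^esub> \<gamma>" using p coset_eq_bottom_row_fibre by simp
  moreover have "\<gamma> \<in> carrier SL2Z" using \<gamma> by (simp add: bottom_row_fibre_def)
  ultimately show "C \<in> rcosets\<^bsub>SL2Z\<^esub> Gamma_inf_plus" unfolding RCOSETS_def by blast
next
  fix C assume "C \<in> rcosets\<^bsub>SL2Z\<^esub> Gamma_inf_plus"
  then obtain \<gamma> where \<gamma>: "\<gamma> \<in> carrier SL2Z" "C = Gamma_inf_plus #>\<^bsub>SL2Z\<^esub> \<gamma>"
    unfolding RCOSETS_def by blast
  define a b c d where "a = \<lfloor>\<gamma>$1$1\<rfloor>" and "b = \<lfloor>\<gamma>$1$2\<rfloor>" and "c = \<lfloor>\<gamma>$2$1\<rfloor>" and "d = \<lfloor>\<gamma>$2$2\<rfloor>"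
  have int: "\<gamma>$1$1 = of_int a" "\<gamma>$1$2 = of_int b" "\<gamma>$2$1 = of_int c" "\<gamma>$2$2 = of_int d"
    using \<gamma> by (simp_all add: SL2Z_iff a_def b_def c_def d_def)
  have "real_of_int (a * d - b * c) = of_int 1"
    using \<gamma>(1) unfolding SL2Z_iff det_2 int by simp
  hence "a * d - b * c = 1" by (simp only: of_int_eq_iff)
  \<comment> \<open>A common divisor of the bottom row divides the determinant.\<close>
  hence "k dvd 1" if "k dvd c" "k dvd d" for k
    using that by (metis dvd_diff dvd_mult)
  hence "coprime c d" by (intro coprimeI)
  moreover have "\<gamma> \<in> bottom_row_fibre (c, d)" using \<gamma> int by (simp add: bottom_row_fibre_def)
  hence "C = bottom_row_fibre (c, d)" unfolding \<gamma>(2) by (rule coset_eq_bottom_row_fibre)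
  ultimately show "C \<in> bottom_row_fibre ` {p. coprime (fst p) (snd p)}"
    by (intro image_eqI[of _ _ "(c, d)"]) auto
qed

text \<open>
  Since \<open>n - \<i> m = - \<i> (m + \<i> n)\<close>, this is the term \<open>(- \<i>)\<^sup>q exp (\<i> q \<theta>(m, n)) / (m\<^sup>2 + n\<^sup>2)\<^sup>s\<close> of the
  lattice sum for the Eisenstein series; the factor \<open>- \<i>\<close> comes from \<open>iwasawa_fun_eq\<close>.
\<close>

definition lattice_term :: "int \<Rightarrow> complex \<Rightarrow> int \<times> int \<Rightarrow> complex" where
  "lattice_term q s p = of_real (of_int ((fst p)\<^sup>2 + (snd p)\<^sup>2)) powr (- s)
     * sgn (Complex (of_int (snd p)) (- of_int (fst p))) powi q"

lemma norm_of_real_powr_nonneg: "x \<ge> 0 \<Longrightarrow> cmod (of_real x powr s) = x powr Re s"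
  by (subst norm_powr_real_powr) auto

lemma norm_lattice_term:
  assumes "p \<noteq> (0, 0)"
  shows "cmod (lattice_term q s p) = of_int ((fst p)\<^sup>2 + (snd p)\<^sup>2) powr (- Re s)"
proof -
  have "Complex (of_int (snd p)) (- of_int (fst p)) \<noteq> 0"
    using assms by (auto simp: complex_eq_iff prod_eq_iff)
  hence "cmod (sgn (Complex (of_int (snd p)) (- of_int (fst p))) powi q) = 1"
    by (simp add: norm_power_int norm_sgn)
  moreover have "cmod (of_real (of_int ((fst p)\<^sup>2 + (snd p)\<^sup>2)) powr (- s))
      = of_int ((fst p)\<^sup>2 + (snd p)\<^sup>2) powr Re (- s)"
    by (rule norm_of_real_powr_nonneg) simp
  ultimately show ?thesis unfolding lattice_term_def norm_mult by simp
qed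

lemma abs_summable_lattice_term:
  assumes "Re s > 1"
  shows "(\<lambda>p. cmod (lattice_term q s p)) summable_on UNIV - {(0, 0)}"
  by (rule summable_on_cong[THEN iffD2, OF _ summable_on_lattice[OF assms]])
     (simp add: norm_lattice_term case_prod_unfold)

lemma iwasawa_fun_bottom_row_fibre:
  assumes "\<gamma> \<in> bottom_row_fibre p"
  shows "iwasawa_fun q s \<gamma> = lattice_term q s p"
proof -
  have "det \<gamma> = 1" and row: "\<gamma>$2$1 = of_int (fst p)" "\<gamma>$2$2 = of_int (snd p)"
    using assms by (simp_all add: bottom_row_fibre_def SL2Z_iff)
  define N :: real where "N = of_int ((fst p)\<^sup>2 + (snd p)\<^sup>2)"
  have "N \<noteq> 0"
  proof
    assume "N = 0"
    hence "(fst p)\<^sup>2 + (snd p)\<^sup>2 = 0" unfolding N_def by (simp only: of_int_eq_0_iff)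
    hence "fst p = 0" "snd p = 0" by (simp_all add: sum_power2_eq_zero_iff)
    thus False using \<open>det \<gamma> = 1\<close> row by (simp add: det_2)
  qed
  moreover have "N \<ge> 0" by (simp add: N_def)
  ultimately have "N > 0" by simp
  hence "complex_of_real (1 / N) powr s = of_real N powr (- s)"
    by (simp add: powr_def Ln_of_real ln_div del: of_real_divide)
  thus ?thesis
    unfolding iwasawa_fun_eq[OF \<open>det \<gamma> = 1\<close>] row lattice_term_def by (simp add: N_def)
qed

text \<open>The representative picked by \<open>SOME\<close> is harmless, because the value of
  \<open>iwasawa_fun\<close> depends only on the bottom row.\<close>

lemma sum_cosets_iwasawa_fun:
  "(\<Sum>\<^sub>\<infinity>C \<in> rcosets\<^bsub>SL2Z\<^esub> Gamma_inf_plus. iwasawa_fun q s ((SOME \<gamma>. \<gamma> \<in> C) ** mat 1))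
     = (\<Sum>\<^sub>\<infinity>p \<in> {p. coprime (fst p) (snd p)}. lattice_term q s p)"
  unfolding infsum_reindex_bij_betw[OF bij_betw_bottom_row_fibre, symmetric]
proof (rule infsum_cong)
  fix p :: "int \<times> int" assume "p \<in> {p. coprime (fst p) (snd p)}"
  hence "\<exists>\<gamma>. \<gamma> \<in> bottom_row_fibre p" using bottom_row_fibre_nonempty by blast
  hence "(SOME \<gamma>. \<gamma> \<in> bottom_row_fibre p) \<in> bottom_row_fibre p" by (rule someI_ex)
  thus "iwasawa_fun q s ((SOME \<gamma>. \<gamma> \<in> bottom_row_fibre p) ** mat 1) = lattice_term q s p"
    by (simp add: iwasawa_fun_bottom_row_fibre)
qed

section \<open>From coprime pairs to all nonzero lattice points\<close>

text \<open>A nonzero lattice point is its greatest common divisor times a unique coprime pair. The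
  divisor is written \<open>Suc n\<close> to match the indexing of
  \<open>zeta_series\<close>.\<close>

lemma bij_betw_scale_coprime:
  "bij_betw (\<lambda>(n, c, d). (int (Suc n) * c, int (Suc n) * d))
     (UNIV \<times> {p. coprime (fst p) (snd p)}) (UNIV - {(0, 0)})"
  unfolding bij_betw_def
proof (intro conjI equalityI subsetI)
  let ?f = "\<lambda>(n, c, d). (int (Suc n) * c, int (Suc n) * d)"
  show "inj_on ?f (UNIV \<times> {p. coprime (fst p) (snd p)})"
  proof (rule inj_onI)
    fix x y :: "nat \<times> int \<times> int"
    assume xy: "x \<in> UNIV \<times> {p. coprime (fst p) (snd p)}" "y \<in> UNIV \<times> {p. coprime (fst p) (snd p)}" "?f x = ?f y"
    obtain n c d n' c' d' where x: "x = (n, c, d)" and y: "y = (n', c', d')"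
      by (cases x, cases y) auto
    have eq: "int (Suc n) * c = int (Suc n') * c'" "int (Suc n) * d = int (Suc n') * d'"
      using xy(3) by (simp_all add: x y del: of_nat_Suc)
    have "gcd (int (Suc n) * c) (int (Suc n) * d) = int (Suc n)"
      "gcd (int (Suc n') * c') (int (Suc n') * d') = int (Suc n')"
      using xy(1,2) by (simp_all add: x y gcd_mult_distrib_int [symmetric] del: of_nat_Suc)
    hence "int (Suc n) = int (Suc n')" unfolding eq by simp
    thus "x = y" using eq by (simp add: x y del: of_nat_Suc)
  qed
  fix p :: "int \<times> int" assume "p \<in> UNIV - {(0, 0)}"
  then obtain a b where p: "p = (a, b)" and ab: "a \<noteq> 0 \<or> b \<noteq> 0" by (cases p) auto
  define n where "n = nat (gcd a b) - 1"
  have n: "int (Suc n) = gcd a b" using ab by (simp add: n_def)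
  obtain c d where "a = gcd a b * c" "b = gcd a b * d" "coprime c d"
    using gcd_coprime_exists[of a b] ab by (auto simp: mult.commute)
  hence "p = ?f (n, c, d)" "(n, c, d) \<in> UNIV \<times> {p. coprime (fst p) (snd p)}"
    using n by (simp_all add: p del: of_nat_Suc)
  thus "p \<in> ?f ` (UNIV \<times> {p. coprime (fst p) (snd p)})" by (rule image_eqI)
next
  fix p assume "p \<in> (\<lambda>(n, c, d). (int (Suc n) * c, int (Suc n) * d)) ` (UNIV \<times> {p. coprime (fst p) (snd p)})"
  thus "p \<in> UNIV - {(0, 0)}" by (auto simp del: of_nat_Suc)
qed

text \<open>Positive scaling multiplies the quadratic form by a square and leaves the direction
  unchanged.\<close>

lemma lattice_term_scale:
  "lattice_term q s (int (Suc n) * c, int (Suc n) * d) = of_nat (Suc n) powr (- (2 * s)) * lattice_term q s (c, d)"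
proof -
  define k :: real where "k = of_nat (Suc n)"
  have k: "k > 0" by (simp add: k_def)
  have "complex_of_real (of_int ((int (Suc n) * c)\<^sup>2 + (int (Suc n) * d)\<^sup>2))
      = of_real k * (of_real k * of_real (of_int (c\<^sup>2 + d\<^sup>2)))"
    by (simp add: k_def power2_eq_square algebra_simps)
  also have "\<dots> powr (- s) = of_real k powr (- s) * (of_real k powr (- s) * of_real (of_int (c\<^sup>2 + d\<^sup>2)) powr (- s))"
    using k by (simp add: powr_times_real)
  also have "\<dots> = of_real k powr (- (2 * s)) * of_real (of_int (c\<^sup>2 + d\<^sup>2)) powr (- s)"
    by (simp flip: powr_add mult.assoc)
  finally have 1: "complex_of_real (of_int ((int (Suc n) * c)\<^sup>2 + (int (Suc n) * d)\<^sup>2)) powr (- s)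
      = of_real k powr (- (2 * s)) * of_real (of_int (c\<^sup>2 + d\<^sup>2)) powr (- s)" .
  have "Complex (of_int (int (Suc n) * d)) (- of_int (int (Suc n) * c))
      = of_real k * Complex (of_int d) (- of_int c)"
    by (simp add: k_def complex_eq_iff)
  hence 2: "sgn (Complex (of_int (int (Suc n) * d)) (- of_int (int (Suc n) * c))) = sgn (Complex (of_int d) (- of_int c))"
    using k by (simp only: sgn_mult sgn_of_real) simp
  show ?thesis unfolding lattice_term_def fst_conv snd_conv 1 2 by (simp add: k_def)
qed

lemma zeta_series_has_sum:
  assumes "Re s > 1"
  shows "((\<lambda>n. of_nat (Suc n) powr (- s)) has_sum zeta_series s) UNIV"
proof -
  have "norm (of_nat (Suc n) powr (- s) :: complex) = real (Suc n) powr (- Re s)" for n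
    using norm_of_real_powr_nonneg[of "real (Suc n)" "- s"] by simp
  moreover have "summable (\<lambda>n. real (Suc n) powr (- Re s))"
    using assms by (subst summable_Suc_iff[of "\<lambda>n. real n powr (- Re s)"]) (simp add: summable_real_powr_iff)
  ultimately have "summable (\<lambda>n. norm (of_nat (Suc n) powr (- s) :: complex))" by (simp only:)
  moreover have "(\<lambda>n. of_nat (Suc n) powr (- s)) sums zeta_series s"
    unfolding zeta_series_def by (rule summable_sums[OF summable_zeta_series[OF assms]])
  ultimately show ?thesis by (rule norm_summable_imp_has_sum)
qed

text \<open>Sorting lattice points by their greatest common divisor makes the absolutely convergent
  sum a product: the divisors give \<open>zeta_series (2 * s)\<close>, and the coprime pairs give
  the sum over cosets.\<close>

lemma eisenstein_sharp_eq_lattice_sum: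
  assumes "Re s > 1"
  shows "eisenstein_sharp (iwasawa_fun q) (mat 1) s = (\<Sum>\<^sub>\<infinity>p \<in> UNIV - {(0, 0)}. lattice_term q s p)"
proof -
  let ?C = "{p :: int \<times> int. coprime (fst p) (snd p)}"
  let ?f = "\<lambda>(n, c, d). (int (Suc n) * c, int (Suc n) * d)"
  have eq: "lattice_term q s (?f x) = (case x of (n, p) \<Rightarrow> of_nat (Suc n) powr (- (2 * s)) * lattice_term q s p)" for x
    using lattice_term_scale by (simp add: case_prod_unfold del: of_nat_Suc)
  have "(\<lambda>p. lattice_term q s p) summable_on UNIV - {(0, 0)}"
    by (rule abs_summable_summable[OF abs_summable_lattice_term[OF assms]])
  hence "(\<lambda>x. lattice_term q s (?f x)) summable_on UNIV \<times> ?C"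
    by (subst summable_on_reindex_bij_betw[OF bij_betw_scale_coprime])
  hence summable: "(\<lambda>(n, p). of_nat (Suc n) powr (- (2 * s)) * lattice_term q s p) summable_on UNIV \<times> ?C"
    unfolding eq .
  have "(\<Sum>\<^sub>\<infinity>p \<in> UNIV - {(0, 0)}. lattice_term q s p) = (\<Sum>\<^sub>\<infinity>x \<in> UNIV \<times> ?C. lattice_term q s (?f x))"
    by (rule infsum_reindex_bij_betw[OF bij_betw_scale_coprime, symmetric])
  also have "\<dots> = (\<Sum>\<^sub>\<infinity>n. \<Sum>\<^sub>\<infinity>p \<in> ?C. of_nat (Suc n) powr (- (2 * s)) * lattice_term q s p)"
    unfolding eq by (rule infsum_Sigma'_banach[OF summable, symmetric])
  also have "\<dots> = (\<Sum>\<^sub>\<infinity>n. of_nat (Suc n) powr (- (2 * s))) * (\<Sum>\<^sub>\<infinity>p \<in> ?C. lattice_term q s p)"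
    by (simp only: infsum_cmult_right' infsum_cmult_left')
  also have "(\<Sum>\<^sub>\<infinity>n. of_nat (Suc n) powr (- (2 * s))) = zeta_series (2 * s)"
    using assms by (intro infsumI zeta_series_has_sum) simp
  finally show ?thesis by (simp only: eisenstein_sharp_def sum_cosets_iwasawa_fun)
qed

section \<open>The Hlawka zeta function\<close>

text \<open>The segment is convex, compact and away from the branch cut, so the derivative of the
  power is bounded there and the mean value inequality applies.\<close>

lemma powr_lipschitz_on_Icc:
  assumes "0 < m"
  obtains L where "L \<ge> 0" "\<And>x y. x \<in> {m..M} \<Longrightarrow> y \<in> {m..M} \<Longrightarrow>
    cmod (of_real x powr a - of_real y powr a) \<le> L * \<bar>x - y\<bar>"
proof -
  define S where "S = complex_of_real ` {m..M}"
  have Re: "Re z > 0" if "z \<in> S" for z using that assms by (auto simp: S_def)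
  have S: "z \<notin> \<real>\<^sub>\<le>\<^sub>0" if "z \<in> S" for z using Re[OF that] by (simp add: complex_nonpos_Reals_iff)
  have "convex S" unfolding S_def
    by (intro convex_linear_image bounded_linear.linear bounded_linear_of_real convex_real_interval)
  have "compact S" unfolding S_def by (intro compact_continuous_image continuous_intros) simp
  have "continuous_on S (\<lambda>z. a * z powr (a - 1))" by (intro continuous_intros) (auto dest: Re)
  hence "bounded ((\<lambda>z. a * z powr (a - 1)) ` S)"
    by (intro compact_imp_bounded compact_continuous_image \<open>compact S\<close>)
  then obtain L where L: "L > 0" "\<And>z. z \<in> S \<Longrightarrow> cmod (a * z powr (a - 1)) \<le> L"
    unfolding bounded_pos by blast
  have "cmod (of_real x powr a - of_real y powr a) \<le> L * cmod (of_real x - of_real y)"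
    if "x \<in> {m..M}" "y \<in> {m..M}" for x y
  proof (rule field_differentiable_bound[OF \<open>convex S\<close> _ L(2)])
    show "((\<lambda>z. z powr a) has_field_derivative a * z powr (a - 1)) (at z within S)" if "z \<in> S" for z
      using S[OF that] by (intro has_field_derivative_at_within[OF has_field_derivative_powr])
  qed (use that in \<open>auto simp: S_def\<close>)
  hence "cmod (of_real x powr a - of_real y powr a) \<le> L * \<bar>x - y\<bar>"
    if "x \<in> {m..M}" "y \<in> {m..M}" for x y
    using that by (simp only: norm_of_real flip: of_real_diff)
  thus thesis using L(1) by (intro that[of L]) auto
qed

text \<open>By periodicity \<open>r\<close> attains a positive minimum and a maximum, and the power
  map is Lipschitz between them. Composition with a Lipschitz map preserves the exponent.\<close>

lemma holder_powr:
  fixes r :: "real \<Rightarrow> real"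
  assumes per: "\<And>\<theta>. r (\<theta> + 2 * pi) = r \<theta>" and pos: "\<And>\<theta>. r \<theta> > 0"
    and hol: "holder_continuous \<alpha> r" and \<alpha>: "\<alpha> > 0"
  obtains K where "\<And>x y. cmod (of_real (r x) powr a - of_real (r y) powr a) \<le> K * \<bar>x - y\<bar> powr \<alpha>"
proof -
  obtain C where C: "\<And>x y. \<bar>r x - r y\<bar> \<le> C * \<bar>x - y\<bar> powr \<alpha>"
    using hol unfolding holder_continuous_def by blast
  have "continuous_on UNIV (\<lambda>x. complex_of_real (r x))"
  proof (rule holder_imp_continuous_on[OF _ \<alpha>])
    show "cmod (complex_of_real (r x) - complex_of_real (r y)) \<le> C * \<bar>x - y\<bar> powr \<alpha>" for x y
      using C[of x y] by (simp flip: of_real_diff)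
  qed
  hence "continuous_on {0..2 * pi} (\<lambda>x. Re (complex_of_real (r x)))"
    by (intro continuous_on_Re) (rule continuous_on_subset, auto)
  hence cont: "continuous_on {0..2 * pi} r" by simp
  have ne: "{0..2 * pi} \<noteq> {}" by simp
  obtain x0 where x0: "\<And>x. x \<in> {0..2 * pi} \<Longrightarrow> r x0 \<le> r x"
    using continuous_attains_inf[OF compact_Icc ne cont] by blast
  obtain x1 where x1: "\<And>x. x \<in> {0..2 * pi} \<Longrightarrow> r x \<le> r x1"
    using continuous_attains_sup[OF compact_Icc ne cont] by blast
  have range: "r x \<in> {r x0..r x1}" for x
  proof -
    have "r (Arg2pi (cis x)) = r x"
      by (rule periodic_cis_eq[where f = r, OF per]) (simp add: cis_Arg2pi sgn_eq)
    moreover have "Arg2pi (cis x) \<in> {0..2 * pi}"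
      using Arg2pi_ge_0[of "cis x"] Arg2pi_lt_2pi[of "cis x"] by simp
    ultimately show ?thesis using x0 x1 by (metis atLeastAtMost_iff)
  qed
  obtain L where L: "L \<ge> 0" "\<And>x y. x \<in> {r x0..r x1} \<Longrightarrow> y \<in> {r x0..r x1} \<Longrightarrow>
      cmod (of_real x powr a - of_real y powr a) \<le> L * \<bar>x - y\<bar>"
    using powr_lipschitz_on_Icc[OF pos] by blast
  have "cmod (of_real (r x) powr a - of_real (r y) powr a) \<le> L * C * \<bar>x - y\<bar> powr \<alpha>" for x y
    using order_trans[OF L(2)[OF range range] mult_left_mono[OF C L(1)]] by (simp add: mult.assoc)
  thus thesis by (rule that)
qed

text \<open>The factor \<open>\<i> powi q\<close> of the claim cancels the power of
  \<open>- \<i>\<close> inside the lattice term, leaving the character at the angle of the lattice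
  point.\<close>

lemma i_power_lattice_term:
  assumes "(m, n) \<noteq> (0, 0)"
  shows "\<i> powi q * lattice_term q s (m, n)
    = cis (of_int q * Arg (Complex (of_int m) (of_int n))) * of_real (of_int (m\<^sup>2 + n\<^sup>2)) powr (- s)"
proof -
  define z where "z = Complex (of_int m) (of_int n)"
  have "z \<noteq> 0" using assms by (auto simp: z_def complex_eq_iff)
  have "Complex (of_int n) (- of_int m) = - \<i> * z" by (simp add: z_def complex_eq_iff)
  hence "sgn (Complex (of_int n) (- of_int m)) = - \<i> * sgn z" by (simp only: sgn_mult) (simp add: sgn_eq)
  hence "\<i> powi q * sgn (Complex (of_int n) (- of_int m)) powi q = (\<i> * (- \<i> * sgn z)) powi q"
    by (simp only: power_int_mult_distrib)
  also have "\<i> * (- \<i> * sgn z) = cis (Arg z)" using \<open>z \<noteq> 0\<close> by (simp add: cis_Arg)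
  also have "cis (Arg z) powi q = cis (of_int q * Arg z)" by (simp add: cis_power_int)
  finally show ?thesis by (simp add: lattice_term_def z_def mult_ac)
qed

theorem theorem16:
  fixes r :: "real \<Rightarrow> real" and \<alpha> :: real and s :: complex
  assumes "\<forall>\<theta>. r (\<theta> + 2 * pi) = r \<theta>"
    and "\<forall>\<theta>. r \<theta> > 0"
    and "\<alpha> > 1 / 2"
    and "holder_continuous \<alpha> r"
    and "Re s > 1"
  shows "hlawka_zeta r s =
           (\<Sum>\<^sub>\<infinity>q::int. \<i> powi q * fourier_coeff (\<lambda>\<theta>. of_real (r \<theta>) powr (2 * s)) q
             * eisenstein_sharp (iwasawa_fun q) (mat 1) s)
         \<and> (\<lambda>q::int. norm (\<i> powi q * fourier_coeff (\<lambda>\<theta>. of_real (r \<theta>) powr (2 * s)) q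
             * eisenstein_sharp (iwasawa_fun q) (mat 1) s)) summable_on UNIV"
proof -
  define h where "h = (\<lambda>\<theta>. complex_of_real (r \<theta>) powr (2 * s))"
  define c where "c = fourier_coeff h"
  define P where "P = (UNIV :: (int \<times> int) set) - {(0, 0)}"
  define w where "w = (\<lambda>p :: int \<times> int. complex_of_real (of_int ((fst p)\<^sup>2 + (snd p)\<^sup>2)) powr (- s))"
  define \<theta> where "\<theta> = (\<lambda>p :: int \<times> int. Arg (Complex (of_int (fst p)) (of_int (snd p))))"
  define F where "F = (\<lambda>q p. c q * cis (of_int q * \<theta> p) * w p)"
  have \<alpha>: "\<alpha> > 0" using assms(3) by simp
  obtain K where hol: "\<And>x y. cmod (h x - h y) \<le> K * \<bar>x - y\<bar> powr \<alpha>"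
    using holder_powr[of r \<alpha> "2 * s"] assms \<alpha> unfolding h_def by blast
  have per: "h (t + 2 * pi) = h t" for t using assms(1) by (simp add: h_def)
  have c_summable: "(\<lambda>q. cmod (c q)) summable_on UNIV"
    unfolding c_def by (rule summable_fourier_coeff_holder[where f = h, OF per hol assms(3)])
  have series: "((\<lambda>q. c q * cis (of_int q * t)) has_sum h t) UNIV" for t
    unfolding c_def using c_summable
    by (intro fourier_series_has_sum[where f = h, OF holder_imp_continuous_on[OF hol \<alpha>] per]) (simp add: c_def)
  have norm_F: "cmod (F q p) = cmod (c q) * cmod (w p)" for q p by (simp add: F_def norm_mult)
  \<comment> \<open>At \<open>q = 0\<close> the directional factor of the lattice term is 1.\<close>
  have w_summable: "(\<lambda>p. cmod (w p)) summable_on P"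
    using abs_summable_lattice_term[OF assms(5), of 0] unfolding P_def
    by (simp add: lattice_term_def w_def)
  \<comment> \<open>Characters have modulus 1, so the norms form a product of two summable families;
    this justifies the exchange of sums below.\<close>
  have abs_F: "(\<lambda>x. norm (case x of (q, p) \<Rightarrow> F q p)) summable_on UNIV \<times> P"
    unfolding Infinite_Sum.abs_summable_on_Sigma_iff using c_summable w_summable
    by (simp add: norm_F infsum_cmult_right' summable_on_cmult_right summable_on_cmult_left abs_mult)
  have coeff: "\<i> powi q * c q * eisenstein_sharp (iwasawa_fun q) (mat 1) s = (\<Sum>\<^sub>\<infinity>p\<in>P. F q p)" for q
  proof -
    have "\<i> powi q * c q * eisenstein_sharp (iwasawa_fun q) (mat 1) s
        = (\<Sum>\<^sub>\<infinity>p\<in>P. c q * (\<i> powi q * lattice_term q s p))"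
      unfolding eisenstein_sharp_eq_lattice_sum[OF assms(5)] P_def infsum_cmult_right' by simp
    also have "\<dots> = (\<Sum>\<^sub>\<infinity>p\<in>P. F q p)"
    proof (rule infsum_cong)
      fix p assume "p \<in> P"
      thus "c q * (\<i> powi q * lattice_term q s p) = F q p"
        using i_power_lattice_term[of "fst p" "snd p" q s] by (simp add: P_def F_def w_def \<theta>_def mult_ac)
    qed
    finally show ?thesis .
  qed
  have "(\<Sum>\<^sub>\<infinity>q. \<i> powi q * c q * eisenstein_sharp (iwasawa_fun q) (mat 1) s) = (\<Sum>\<^sub>\<infinity>q. \<Sum>\<^sub>\<infinity>p\<in>P. F q p)"
    by (simp only: coeff)
  also have "\<dots> = (\<Sum>\<^sub>\<infinity>p\<in>P. \<Sum>\<^sub>\<infinity>q. F q p)"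
    by (rule infsum_swap_banach[OF abs_summable_summable[OF abs_F]])
  \<comment> \<open>The inner sum is the Fourier series of \<open>h\<close> at the angle of
    \<open>p\<close>.\<close>
  also have "\<dots> = (\<Sum>\<^sub>\<infinity>p\<in>P. h (\<theta> p) * w p)"
    unfolding F_def infsum_cmult_left' using infsumI[OF series] by simp
  also have "\<dots> = hlawka_zeta r s"
    by (simp add: hlawka_zeta_def P_def h_def \<theta>_def w_def case_prod_unfold)
  finally have 1: "hlawka_zeta r s = (\<Sum>\<^sub>\<infinity>q. \<i> powi q * c q * eisenstein_sharp (iwasawa_fun q) (mat 1) s)" ..
  \<comment> \<open>The lattice sums are bounded by one constant independent of \<open>q\<close>, so
    the coefficients of \<open>h\<close> dominate.\<close>
  have "(\<lambda>q. norm (\<Sum>\<^sub>\<infinity>p\<in>P. F q p)) summable_on UNIV"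
  proof (rule Infinite_Sum.abs_summable_on_comparison_test)
    show "(\<lambda>q. norm (cmod (c q) * (\<Sum>\<^sub>\<infinity>p\<in>P. cmod (w p)))) summable_on UNIV"
      using summable_on_cmult_left[OF c_summable] by (simp add: abs_mult infsum_nonneg)
    fix q :: int
    have "(\<lambda>p. cmod (F q p)) summable_on P"
      unfolding norm_F by (intro summable_on_cmult_right w_summable)
    hence "cmod (\<Sum>\<^sub>\<infinity>p\<in>P. F q p) \<le> (\<Sum>\<^sub>\<infinity>p\<in>P. cmod (F q p))" by (rule norm_infsum_bound)
    thus "cmod (\<Sum>\<^sub>\<infinity>p\<in>P. F q p) \<le> norm (cmod (c q) * (\<Sum>\<^sub>\<infinity>p\<in>P. cmod (w p)))"
      by (simp add: norm_F infsum_cmult_right' abs_mult infsum_nonneg)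
  qed
  hence 2: "(\<lambda>q. norm (\<i> powi q * c q * eisenstein_sharp (iwasawa_fun q) (mat 1) s)) summable_on UNIV"
    by (simp only: coeff)
  show ?thesis using 1 2 unfolding c_def h_def by (rule conjI)
qed

end
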